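(* Let $S=(\mathbb{CP}^1,\Omega,\infty)$ be a stability theory, and suppose that $\Omega_{ss}$ is homeomorphic to $S^1$ (e.g. in the case of compact convex closure of an open $\Omega_s$, or in the case of Hurwitz stability theory, Schur stability theory or (quasi)hyperbolicity theory). Then the strata $(k,0,m)_S$ are homeomorphic to $\mathbb R^{2(k+m)}$, and for $l>0$ the strata $(k,l,m)_S$ are homeomorphic to $S^1\times D^{l-1}\times\mathbb R^{2(k+m)}$ if $l$ is odd, and to $S^1\widetilde\times D^{l-1}\times\mathbb R^{2(k+m)}$ if $l$ is even.
   Context: A stability theory $S=(\mathbb{CP}^1,\Omega,\infty)$ is given by a semialgebraic subset $\Omega$ of $\mathbb{CP}^1=\mathbb C\cup\{\infty\}$ (viewed as a real algebraic variety), with strata $\Omega_s=\Omega$, $\Omega_{ss}=\overline\Omega\setminus\Omega$, $\Omega_{un}=\mathbb{CP}^1\setminus\overline\Omega$ (Euclidean closure). $(\mathbb{CP}^1)^{(n)}=(\mathbb{CP}^1)^n/\Sigma_n$ is the $n$-th symmetric product (multisets of cardinality $n$), identified with nonzero complex binary forms of degree $n$ up to scalar via roots. For nonnegative integers $k,l,m$ the $D$-stratum $(k,l,m)_S\subseteq(\mathbb{CP}^1)^{(k+l+m)}$ is the set of multisets with exactly $k,l,m$ points (with multiplicity) in $\Omega_s,\Omega_{ss},\Omega_{un}$. $D^{j}$ is the closed $j$-dimensional disc, and $S^1\widetilde\times D^{j}$ is the unique non-orientable $D^{j}$-bundle over $S^1$. Hurwitz stability: $\Omega=\{\mathrm{Re}\,z<0\}$;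 Schur stability: $\Omega=\{|z|<1\}$; hyperbolicity: $\Omega=\{\mathrm{Im}\,z<0\}$, with border the real line.
   Formalization: The formal theorem also assumes Ω is open and connected in CP^1. Without this the claim fails: for Ω = CP^1 minus the unit circle, Ω_ss = S^1 but (0,0,1)_S is empty. Since (1,0,0)_S ≅ Ω, the conclusion itself forces both conditions. *)

theory Defs
  imports "HOL-Analysis.Analysis"
begin

section \<open>The real algebraic variety $\mathbb{CP}^1 = \mathbb{C} \cup \{\infty\}$\<close>

text \<open>The point at infinity is \<^term>\<open>None\<close>; a finite point \<open>z\<close> is \<^term>\<open>Some z\<close>.\<close>

definition CP1 :: "complex option topology" where
  "CP1 = Alexandroff_compactification euclidean"

text \<open>
  Semialgebraic sets form the smallest Boolean algebra of sets containing all \<open>{x. p x > 0}\<close> with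
  \<open>p\<close> a real polynomial. On \<^typ>\<open>complex\<close>, the real polynomial functions are exactly the
  polynomials with real coefficients in \<open>Re z\<close> and \<open>Im z\<close>.
\<close>

inductive semialgebraic :: "'a::euclidean_space set \<Rightarrow> bool" where
  pos: "real_polynomial_function p \<Longrightarrow> semialgebraic {x. p x > 0}"
| Compl: "semialgebraic A \<Longrightarrow> semialgebraic (- A)"
| Un: "semialgebraic A \<Longrightarrow> semialgebraic B \<Longrightarrow> semialgebraic (A \<union> B)"

text \<open>The inverse of the affine chart \<open>w = 1 / z\<close> around \<open>\<infinity>\<close>.\<close>

definition chart_at_infinity :: "complex \<Rightarrow> complex option" where
  "chart_at_infinity w = (if w = 0 then None else Some (1 / w))"

text \<open>A subset of $\mathbb{CP}^1$ is semialgebraic if it is so in both standard affine charts.\<close>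

definition semialgebraic_CP1 :: "complex option set \<Rightarrow> bool" where
  "semialgebraic_CP1 A \<longleftrightarrow> semialgebraic (Some -` A) \<and> semialgebraic (chart_at_infinity -` A)"


section \<open>Stability theories and their strata\<close>

text \<open>
  The first and third components of \<open>S = (\<complex>P\<^sup>1, \<Omega>, \<infinity>)\<close> are constant, so a
  stability theory is given by the set \<open>\<Omega>\<close>.
\<close>

definition stability_theory :: "complex option set \<Rightarrow> bool" where
  "stability_theory \<Omega> \<longleftrightarrow> semialgebraic_CP1 \<Omega>"

definition stable :: "complex option set \<Rightarrow> complex option set" where
  "stable \<Omega> = \<Omega>"

definition semistable :: "complex option set \<Rightarrow> complex option set" where
  "semistable \<Omega> = CP1 closure_of \<Omega> - \<Omega>"

definition unstable :: "complex option set \<Rightarrow> complex option set" where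
  "unstable \<Omega> = topspace CP1 - CP1 closure_of \<Omega>"


section \<open>Symmetric products and D-strata\<close>

lemma istopology_quotient:
  "istopology (\<lambda>U. U \<subseteq> q ` topspace X \<and> openin X {x \<in> topspace X. q x \<in> U})"
proof -
  have "openin X {x \<in> topspace X. q x \<in> S \<inter> T}"
    if "openin X {x \<in> topspace X. q x \<in> S}" "openin X {x \<in> topspace X. q x \<in> T}" for S T
  proof -
    have "{x \<in> topspace X. q x \<in> S \<inter> T} =
        {x \<in> topspace X. q x \<in> S} \<inter> {x \<in> topspace X. q x \<in> T}"
      by auto
    then show ?thesis using that by auto
  qed
  moreover have "openin X {x \<in> topspace X. q x \<in> \<Union>\<K>}"
    if "\<forall>K\<in>\<K>. openin X {x \<in> topspace X. q x \<in> K}" for \<K>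
  proof -
    have "{x \<in> topspace X. q x \<in> \<Union>\<K>} = (\<Union>K\<in>\<K>. {x \<in> topspace X. q x \<in> K})"
      by auto
    then show ?thesis using that by auto
  qed
  ultimately show ?thesis
    unfolding istopology_def by (auto simp: Sup_le_iff)
qed

definition quotient_topology :: "'a topology \<Rightarrow> ('a \<Rightarrow> 'b) \<Rightarrow> 'b topology" where
  "quotient_topology X q =
     topology (\<lambda>U. U \<subseteq> q ` topspace X \<and> openin X {x \<in> topspace X. q x \<in> U})"

lemma openin_quotient_topology:
  "openin (quotient_topology X q) U \<longleftrightarrow>
     U \<subseteq> q ` topspace X \<and> openin X {x \<in> topspace X. q x \<in> U}"
  unfolding quotient_topology_def by (simp add: istopology_quotient)

lemma topspace_quotient_topology [simp]: "topspace (quotient_topology X q) = q ` topspace X"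
proof
  show "topspace (quotient_topology X q) \<subseteq> q ` topspace X"
    by (metis openin_quotient_topology openin_topspace)
  have "{x \<in> topspace X. q x \<in> q ` topspace X} = topspace X"
    by auto
  then show "q ` topspace X \<subseteq> topspace (quotient_topology X q)"
    by (simp add: openin_quotient_topology openin_subset)
qed

lemma quotient_map_quotient_topology: "quotient_map X (quotient_topology X q) q"
  by (auto simp: quotient_map_def openin_quotient_topology)

text \<open>
  \<open>X\<^sup>n / \<Sigma>\<^sub>n\<close>: two \<open>n\<close>-tuples lie in the same orbit iff they have the same multiset of entries.
\<close>

definition sym_product :: "'a topology \<Rightarrow> nat \<Rightarrow> 'a multiset topology" where
  "sym_product X n =
     quotient_topology (product_topology (\<lambda>_. X) {..<n}) (\<lambda>x. image_mset x (mset_set {..<n}))"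

definition D_stratum :: "complex option set \<Rightarrow> nat \<Rightarrow> nat \<Rightarrow> nat \<Rightarrow> complex option multiset set" where
  "D_stratum \<Omega> k l m = {M \<in> topspace (sym_product CP1 (k + l + m)).
     size {#z \<in># M. z \<in> stable \<Omega>#} = k \<and>
     size {#z \<in># M. z \<in> semistable \<Omega>#} = l \<and>
     size {#z \<in># M. z \<in> unstable \<Omega>#} = m}"

definition D_stratum_topology ::
    "complex option set \<Rightarrow> nat \<Rightarrow> nat \<Rightarrow> nat \<Rightarrow> complex option multiset topology" where
  "D_stratum_topology \<Omega> k l m = subtopology (sym_product CP1 (k + l + m)) (D_stratum \<Omega> k l m)"


section \<open>Model spaces\<close>

abbreviation circle :: "complex topology" where
  "circle \<equiv> top_of_set (sphere 0 1)"

definition closed_disc :: "nat \<Rightarrow> (nat \<Rightarrow> real) topology" where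
  "closed_disc j = subtopology (Euclidean_space j) {x. (\<Sum>i<j. (x i)\<^sup>2) \<le> 1}"

text \<open>
  The non-orientable \<open>D\<^sup>j\<close>-bundle over \<open>S\<^sup>1\<close> (\<open>j \<ge> 1\<close>), with structure group \<open>O(j)\<close>: bundles over
  \<open>S\<^sup>1\<close> are classified by the component of the gluing map, and the non-orientable one is obtained
  from \<open>[0, 1] \<times> D\<^sup>j\<close> by identifying \<open>(1, x)\<close> with \<open>(0, \<rho> x)\<close>, where \<open>\<rho>\<close> is the reflection in the
  first coordinate. For \<open>j = 1\<close> this is the closed Moebius band.
\<close>

definition nonorientable_disc_bundle :: "nat \<Rightarrow> (real \<times> (nat \<Rightarrow> real)) topology" where
  "nonorientable_disc_bundle j =
     quotient_topology (prod_topology (top_of_set {0..1}) (closed_disc j))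
       (\<lambda>(t, x). if t = 1 then (0, x(0 := - x 0)) else (t, x))"


section \<open>Examples satisfying the hypotheses\<close>

definition schur_region :: "complex option set" where
  "schur_region = Some ` {z. cmod z < 1}"

definition hurwitz_region :: "complex option set" where
  "hurwitz_region = Some ` {z. Re z < 0}"

definition hyperbolic_region :: "complex option set" where
  "hyperbolic_region = Some ` {z. Im z < 0}"

lemma vimage_Some_image_Some: "Some -` Some ` A = A"
  by auto

lemma vimage_chart_at_infinity: "chart_at_infinity -` Some ` A = {w. w \<noteq> 0 \<and> 1 / w \<in> A}"
  by (auto simp: chart_at_infinity_def image_iff split: if_splits)

lemma topspace_CP1 [simp]: "topspace CP1 = UNIV"
  by (simp add: CP1_def UNIV_option_conv)

lemma openin_CP1_image_Some [simp]: "openin CP1 (Some ` U) \<longleftrightarrow> open U"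
  by (simp add: CP1_def)

lemma continuous_map_Some_CP1: "continuous_map euclidean CP1 Some"
  by (simp add: CP1_def continuous_map_Some)

lemma Hausdorff_space_CP1: "Hausdorff_space CP1"
  unfolding CP1_def Hausdorff_space_Alexandroff_compactification
  by (metis Hausdorff_space_euclidean locally_compact_space_euclidean)

lemma connectedin_CP1_image_Some: "connected U \<Longrightarrow> connectedin CP1 (Some ` U)"
  by (rule connectedin_continuous_map_image[OF continuous_map_Some_CP1]) simp

lemma image_Some_closure_subset: "Some ` closure U \<subseteq> CP1 closure_of (Some ` U)"
  using continuous_map_image_closure_subset[OF continuous_map_Some_CP1, of U] by simp

lemma circle_homeomorphicI:
  assumes "continuous_map circle CP1 h" "inj_on h (sphere 0 1)" "h ` sphere 0 1 = B"
  shows "subtopology CP1 B homeomorphic_space circle"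
proof -
  have "homeomorphic_map circle (subtopology CP1 B) h"
    using assms
    by (intro continuous_imp_homeomorphic_map)
       (auto simp: continuous_map_in_subtopology Hausdorff_space_subtopology Hausdorff_space_CP1
          compact_space_subtopology)
  then show ?thesis
    using homeomorphic_map_imp_homeomorphic_space homeomorphic_space_sym by blast
qed

lemma bounded_convex_region:
  assumes "open U" "convex U" "bounded U" "U \<noteq> {}"
  shows "openin CP1 (Some ` U)" "connectedin CP1 (Some ` U)"
    "subtopology CP1 (semistable (Some ` U)) homeomorphic_space circle"
proof -
  show "openin CP1 (Some ` U)" "connectedin CP1 (Some ` U)"
    using assms by (auto intro: connectedin_CP1_image_Some convex_connected)
  have "closedin CP1 (Some ` closure U)"
    using assms by (simp add: CP1_def)
  then have "CP1 closure_of (Some ` U) = Some ` closure U"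
    by (intro subset_antisym closure_of_minimal image_mono closure_subset image_Some_closure_subset)
  then have ss: "semistable (Some ` U) = Some ` frontier U"
    using assms by (auto simp: semistable_def frontier_def interior_open)
  have "aff_dim U = aff_dim (ball (0::complex) 1)"
    using assms by (simp add: aff_dim_open)
  then have "rel_frontier (ball (0::complex) 1) homeomorphic rel_frontier U"
    using assms by (intro homeomorphic_rel_frontiers_convex_bounded_sets) auto
  moreover have "affine hull U = UNIV"
    using assms by (simp add: affine_hull_open)
  ultimately have "sphere (0::complex) 1 homeomorphic frontier U"
    by (simp add: rel_frontier_frontier affine_hull_open)
  then obtain f g where fg: "homeomorphism (sphere (0::complex) 1) (frontier U) f g"
    by (auto simp: homeomorphic_def)
  have "continuous_map circle CP1 (Some \<circ> f)"
    using fg continuous_map_Some_CP1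
    by (intro continuous_map_compose[where X' = euclidean]) (auto simp: homeomorphism_def)
  moreover have "inj_on (Some \<circ> f) (sphere 0 1)"
    using fg unfolding homeomorphism_def inj_on_def by (metis comp_apply option.inject)
  moreover have "(Some \<circ> f) ` sphere 0 1 = Some ` frontier U"
    using fg unfolding image_comp[symmetric] by (simp add: homeomorphism_def)
  ultimately show "subtopology CP1 (semistable (Some ` U)) homeomorphic_space circle"
    unfolding ss by (rule circle_homeomorphicI)
qed

lemma half_plane_region:
  fixes e :: complex
  assumes "e \<noteq> 0"
  defines "U \<equiv> {z. e \<bullet> z < 0}"
  shows "openin CP1 (Some ` U)" "connectedin CP1 (Some ` U)"
    "subtopology CP1 (semistable (Some ` U)) homeomorphic_space circle"
proof -
  let ?L = "{z. e \<bullet> z = 0}"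
  show "openin CP1 (Some ` U)" "connectedin CP1 (Some ` U)"
    unfolding U_def
    by (auto intro!: connectedin_CP1_image_Some convex_connected convex_halfspace_lt open_halfspace_lt)
  have clU: "closure U = {z. e \<bullet> z \<le> 0}"
    using assms unfolding U_def by (simp add: closure_halfspace_lt)
  have closed: "closedin CP1 (insert None (Some ` closure U))"
  proof -
    have "x \<in> UNIV - insert None (Some ` closure U) \<longleftrightarrow> x \<in> Some ` (- closure U)" for x
      by (cases x) auto
    then have "UNIV - insert None (Some ` closure U) = Some ` (- closure U)"
      by blast
    then show ?thesis
      by (simp add: closedin_def open_Compl)
  qed
  have None: "None \<in> CP1 closure_of (Some ` U)"
  proof (rule ccontr)
    assume "None \<notin> CP1 closure_of (Some ` U)"
    then have "x \<in> CP1 closure_of (Some ` U) \<longleftrightarrow> x \<in> Some ` (Some -` (CP1 closure_of (Some ` U)))" for x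
      by (cases x) auto
    then have "CP1 closure_of (Some ` U) = Some ` (Some -` (CP1 closure_of (Some ` U)))"
      by blast
    then have "compact (Some -` (CP1 closure_of (Some ` U)))"
      using closedin_Alexandroff_compactification_image_Some[of euclidean]
      unfolding CP1_def by (metis closedin_closure_of compactin_euclidean_iff)
    moreover have "U \<subseteq> Some -` (CP1 closure_of (Some ` U))"
      using image_Some_closure_subset[of U] closure_subset[of U] by auto
    ultimately have "bounded U"
      using bounded_subset compact_imp_bounded by blast
    then obtain B where B: "\<And>z. z \<in> U \<Longrightarrow> norm z \<le> B"
      by (auto simp: bounded_iff)
    define t where "t = (\<bar>B\<bar> + 1) / norm e"
    have "t > 0" "t * norm e = \<bar>B\<bar> + 1"
      using assms by (auto simp: t_def intro: divide_pos_pos)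
    then have "- (t *\<^sub>R e) \<in> U"
      using assms unfolding U_def by simp
    then have "norm (- (t *\<^sub>R e)) \<le> B"
      by (rule B)
    then show False
      using \<open>t > 0\<close> \<open>t * norm e = \<bar>B\<bar> + 1\<close> by simp
  qed
  have "CP1 closure_of (Some ` U) = insert None (Some ` closure U)"
    using None image_Some_closure_subset[of U] closure_subset[of U]
    by (intro subset_antisym closure_of_minimal closed) auto
  then have ss: "semistable (Some ` U) = insert None (Some ` ?L)"
    unfolding semistable_def clU by (auto simp: U_def image_iff)
  have "sphere (0::complex) 1 - {1} homeomorphic ?L"
    using assms by (intro homeomorphic_punctured_sphere_hyperplane) auto
  then obtain f g where fg: "homeomorphism (sphere (0::complex) 1 - {1}) ?L f g"
    by (auto simp: homeomorphic_def)
  define h where "h w = (if w = 1 then None else Some (f w))" for w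
  have "openin circle {w \<in> topspace circle. h w \<in> V}" if V: "openin CP1 V" for V
  proof -
    from V consider W where "open W" "V = Some ` W"
      | C where "compact C" "V = insert None (Some ` (- C))"
      unfolding CP1_def openin_Alexandroff_compactification by (auto simp: Compl_eq_Diff_UNIV)
    then show ?thesis
    proof cases
      case 1
      have "openin (top_of_set (sphere 0 1 - {1})) ((sphere 0 1 - {1}) \<inter> f -` W)"
        using fg 1 by (intro continuous_openin_preimage_gen) (auto simp: homeomorphism_def)
      moreover have "openin circle (sphere 0 1 - {1})"
        by (simp add: openin_delete)
      ultimately have "openin circle ((sphere 0 1 - {1}) \<inter> f -` W)"
        using openin_trans by blast
      moreover have "{w \<in> topspace circle. h w \<in> V} = (sphere 0 1 - {1}) \<inter> f -` W"
        using 1 by (auto simp: h_def)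
      ultimately show ?thesis by simp
    next
      case 2
      have "compact (C \<inter> ?L)"
        using 2 by (intro compact_Int_closed closed_hyperplane)
      then have "compact (g ` (C \<inter> ?L))"
        using fg by (intro compact_continuous_image)
          (auto simp: homeomorphism_def intro: continuous_on_subset)
      then have "closed (g ` (C \<inter> ?L))"
        by (rule compact_imp_closed)
      moreover have "{w \<in> topspace circle. h w \<in> V} = sphere 0 1 \<inter> - (g ` (C \<inter> ?L))"
      proof -
        have "w \<in> g ` (C \<inter> ?L) \<longleftrightarrow> w \<noteq> 1 \<and> f w \<in> C" if "w \<in> sphere 0 1" for w
        proof
          assume "w \<in> g ` (C \<inter> ?L)"
          then obtain z where "z \<in> C" "z \<in> ?L" "w = g z"
            by blast
          moreover from this have "g z \<in> sphere 0 1 - {1}" "f (g z) = z"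
            using fg unfolding homeomorphism_def by blast+
          ultimately show "w \<noteq> 1 \<and> f w \<in> C"
            by auto
        next
          assume w: "w \<noteq> 1 \<and> f w \<in> C"
          then have "w \<in> sphere 0 1 - {1}"
            using that by blast
          then have "f w \<in> ?L" "w = g (f w)"
            using fg unfolding homeomorphism_def by (blast, simp)
          then show "w \<in> g ` (C \<inter> ?L)"
            using w by blast
        qed
        moreover have "h w \<in> V \<longleftrightarrow> \<not> (w \<noteq> 1 \<and> f w \<in> C)" for w
          using 2 by (auto simp: h_def)
        ultimately show ?thesis
          by (simp only: topspace_euclidean_subtopology) blast
      qed
      ultimately show ?thesis
        by (metis open_Compl openin_open_Int)
    qed
  qed
  then have "continuous_map circle CP1 h"
    by (auto simp: continuous_map_def)
  moreover have "inj_on h (sphere 0 1)"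
  proof (rule inj_onI)
    fix v w assume *: "v \<in> sphere 0 1" "w \<in> sphere 0 1" "h v = h w"
    show "v = w"
    proof (cases "v = 1 \<or> w = 1")
      case True
      then show ?thesis
        using *(3) by (auto simp: h_def split: if_splits)
    next
      case False
      then have "v \<in> sphere 0 1 - {1}" "w \<in> sphere 0 1 - {1}" "f v = f w"
        using * by (auto simp: h_def)
      moreover from this have "g (f v) = v" "g (f w) = w"
        using fg unfolding homeomorphism_def by blast+
      ultimately show ?thesis by metis
    qed
  qed
  moreover have "h ` sphere 0 1 = insert None (Some ` ?L)"
  proof -
    have "h ` (sphere 0 1 - {1}) = Some ` f ` (sphere 0 1 - {1})"
      unfolding image_image by (intro image_cong) (auto simp: h_def)
    moreover have "sphere 0 1 = insert 1 (sphere (0::complex) 1 - {1})"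
      by auto
    ultimately show ?thesis
      using fg by (metis h_def homeomorphism_def image_insert)
  qed
  ultimately show "subtopology CP1 (semistable (Some ` U)) homeomorphic_space circle"
    unfolding ss by (rule circle_homeomorphicI)
qed

lemma semialgebraic_pos_polynomial:
  "real_polynomial_function p \<Longrightarrow> A = {z. p z > 0} \<Longrightarrow> semialgebraic A"
  using semialgebraic.pos by simp

lemma real_polynomial_Re_Im [intro]: "real_polynomial_function Re" "real_polynomial_function Im"
  by (auto intro: real_polynomial_function.intros(1) bounded_linear_Re bounded_linear_Im)

lemma stability_theory_schur: "stability_theory schur_region"
  unfolding stability_theory_def semialgebraic_CP1_def schur_region_def
    vimage_Some_image_Some vimage_chart_at_infinity
proof
  have "real_polynomial_function (\<lambda>z. 1 + - 1 * (Re z * Re z + Im z * Im z))"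
    by (intro real_polynomial_function.intros(3) real_polynomial_function.intros(4)
        real_polynomial_function.intros(2) real_polynomial_Re_Im)
  then show "semialgebraic {z. cmod z < 1}"
    by (rule semialgebraic_pos_polynomial)
       (auto simp: cmod_def power2_eq_square)
  have "real_polynomial_function (\<lambda>z. (Re z * Re z + Im z * Im z) + - 1)"
    by (intro real_polynomial_function.intros(3) real_polynomial_function.intros(4)
        real_polynomial_function.intros(2) real_polynomial_Re_Im)
  moreover have "1 < (cmod z)\<^sup>2 \<longleftrightarrow> 1 < cmod z" for z
    using abs_square_le_1[of "cmod z"] by (simp flip: not_le)
  ultimately have "semialgebraic {w. 1 < cmod w}"
    by (intro semialgebraic_pos_polynomial[where p = "\<lambda>z. (Re z * Re z + Im z * Im z) + - 1"])
       (auto simp: cmod_power2 power2_eq_square[symmetric])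
  moreover have "{w. w \<noteq> 0 \<and> 1 / w \<in> {z. cmod z < 1}} = {w. 1 < cmod w}"
    by (auto simp: norm_divide divide_less_eq)
  ultimately show "semialgebraic {w. w \<noteq> 0 \<and> 1 / w \<in> {z. cmod z < 1}}"
    by simp
qed

lemma stability_theory_hurwitz: "stability_theory hurwitz_region"
  unfolding stability_theory_def semialgebraic_CP1_def hurwitz_region_def
    vimage_Some_image_Some vimage_chart_at_infinity
proof
  have *: "real_polynomial_function (\<lambda>z. - 1 * Re z)"
    by (intro real_polynomial_function.intros(4) real_polynomial_function.intros(2) real_polynomial_Re_Im)
  then show "semialgebraic {z. Re z < 0}"
    by (rule semialgebraic_pos_polynomial) auto
  from * show "semialgebraic {w. w \<noteq> 0 \<and> 1 / w \<in> {z. Re z < 0}}"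
    by (rule semialgebraic_pos_polynomial) (auto simp: Re_divide divide_less_0_iff sum_power2_gt_zero_iff not_sum_power2_lt_zero)
qed

lemma stability_theory_hyperbolic: "stability_theory hyperbolic_region"
  unfolding stability_theory_def semialgebraic_CP1_def hyperbolic_region_def
    vimage_Some_image_Some vimage_chart_at_infinity
proof
  have "real_polynomial_function (\<lambda>z. - 1 * Im z)"
    by (intro real_polynomial_function.intros(4) real_polynomial_function.intros(2) real_polynomial_Re_Im)
  then show "semialgebraic {z. Im z < 0}"
    by (rule semialgebraic_pos_polynomial) auto
  show "semialgebraic {w. w \<noteq> 0 \<and> 1 / w \<in> {z. Im z < 0}}"
    by (rule semialgebraic_pos_polynomial[OF real_polynomial_Re_Im(2)])
       (auto simp: Im_divide zero_less_divide_iff sum_power2_gt_zero_iff not_sum_power2_lt_zero)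
qed

lemma schur_region:
  "openin CP1 schur_region" "connectedin CP1 schur_region"
  "subtopology CP1 (semistable schur_region) homeomorphic_space circle"
proof -
  have "{z. cmod z < 1} = ball 0 1"
    by auto
  then show "openin CP1 schur_region" "connectedin CP1 schur_region"
    "subtopology CP1 (semistable schur_region) homeomorphic_space circle"
    unfolding schur_region_def using bounded_convex_region[of "ball 0 1"] by auto
qed

lemma hurwitz_region:
  "openin CP1 hurwitz_region" "connectedin CP1 hurwitz_region"
  "subtopology CP1 (semistable hurwitz_region) homeomorphic_space circle"
  unfolding hurwitz_region_def using half_plane_region[of 1] by (auto simp: inner_complex_def)

lemma hyperbolic_region:
  "openin CP1 hyperbolic_region" "connectedin CP1 hyperbolic_region"
  "subtopology CP1 (semistable hyperbolic_region) homeomorphic_space circle"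
  unfolding hyperbolic_region_def using half_plane_region[of \<i>] by (auto simp: inner_complex_def)


section \<open>Necessity of the hypotheses on \<Omega>\<close>

text \<open>
  That \<open>\<Omega>\<^sub>s\<^sub>s\<close> is a circle does not by itself make \<open>\<Omega>\<close> one of the two discs bounded by that circle,
  which is what the description of the strata requires: \<open>(1, 0, 0)\<close> is homeomorphic to \<open>\<Omega>\<close> and
  \<open>(0, 0, 1)\<close> to \<open>\<Omega>\<^sub>u\<^sub>n\<close>. Openness excludes sets such as \<open>{z. |z| < 1} \<union> {2}\<close> and
  \<open>{z. 1/2 \<le> |z| < 1}\<close>, whose semistable locus is the unit circle. Connectedness excludes the
  complement of the circle, for which the unstable locus is empty.
\<close>

definition circle_complement :: "complex option set" where
  "circle_complement = - Some ` sphere 0 1"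

lemma closure_of_circle_complement: "CP1 closure_of circle_complement = UNIV"
proof -
  have "CP1 interior_of (Some ` sphere 0 1) = {}"
  proof -
    have "U = {}" if "openin CP1 U" "U \<subseteq> Some ` sphere 0 1" for U
    proof -
      from that(2) obtain W where W: "U = Some ` W" "W \<subseteq> sphere 0 1"
        by (auto simp: subset_image_iff)
      then have "open W"
        using that by simp
      moreover have "negligible W"
        using W(2) negligible_sphere negligible_subset by blast
      ultimately show ?thesis
        using W(1) open_not_negligible by auto
    qed
    then show ?thesis
      using interior_of_subset openin_interior_of by metis
  qed
  then show ?thesis
    by (simp add: circle_complement_def closure_of_complement Compl_eq_Diff_UNIV
        closure_of_interior_of double_diff)
qed

lemma circle_complement:
  "stability_theory circle_complement"
  "openin CP1 circle_complement"
  "subtopology CP1 (semistable circle_complement) homeomorphic_space circle"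
  "\<not> D_stratum_topology circle_complement 0 0 1 homeomorphic_space Euclidean_space 2"
proof -
  have ss: "semistable circle_complement = Some ` sphere 0 1"
    unfolding semistable_def closure_of_circle_complement by (auto simp: circle_complement_def)
  have un: "unstable circle_complement = {}"
    unfolding unstable_def closure_of_circle_complement by simp
  have *: "sphere 0 1 = - ({z. 0 < 1 + - 1 * (Re z * Re z + Im z * Im z)} \<union>
      {z. 0 < (Re z * Re z + Im z * Im z) + - 1})"
    by (auto simp: cmod_def power2_eq_square)
  have "semialgebraic (sphere (0::complex) 1)"
    unfolding *
    by (intro semialgebraic.intros real_polynomial_function.intros(2-4) real_polynomial_Re_Im)
  then have "semialgebraic (- sphere (0::complex) 1)"
    by (rule semialgebraic.Compl)
  moreover have "Some -` circle_complement = - sphere 0 1"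
    "chart_at_infinity -` circle_complement = - sphere 0 1"
    by (auto simp: circle_complement_def chart_at_infinity_def norm_divide inj_image_mem_iff
        split: if_splits)
  ultimately show "stability_theory circle_complement"
    by (simp add: stability_theory_def semialgebraic_CP1_def)
  have "closedin CP1 (Some ` sphere 0 1)"
    by (simp add: CP1_def)
  then show "openin CP1 circle_complement"
    by (simp add: circle_complement_def closedin_def Compl_eq_Diff_UNIV)
  show "subtopology CP1 (semistable circle_complement) homeomorphic_space circle"
    unfolding ss
    by (rule circle_homeomorphicI[of Some])
       (auto intro: continuous_map_from_subtopology continuous_map_Some_CP1)
  have "topspace (D_stratum_topology circle_complement 0 0 1) = {}"
    by (auto simp: D_stratum_topology_def D_stratum_def un)
  moreover have "topspace (Euclidean_space 2) \<noteq> {}"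
    by (auto simp: topspace_Euclidean_space)
  ultimately show
    "\<not> D_stratum_topology circle_complement 0 0 1 homeomorphic_space Euclidean_space 2"
    using homeomorphic_empty_space by (metis null_topspace_iff_trivial)
qed

end

theory Submission
  imports Defs
    "HOL-Combinatorics.Permutations"
    "HOL-Computational_Algebra.Fundamental_Theorem_Algebra"
    "HOL-Complex_Analysis.Riemann_Mapping"
begin

text \<open>
  The boundary \<open>\<Omega>\<^sub>s\<^sub>s\<close> is a Jordan curve, and \<open>\<Omega>\<close>, being connected, open, and closed in the complement
  of that curve, is one of its two sides; \<open>\<Omega>\<^sub>u\<^sub>n\<close> is the other. The inside of a plane Jordan curve is
  simply connected, hence homeomorphic to the plane by the Riemann mapping theorem. Moving a point of
  \<open>\<Omega>\<close>, or of \<open>\<Omega>\<^sub>u\<^sub>n\<close>, to infinity turns the opposite side into such an inside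
  (\<open>stable_unstable_homeomorphic_space_complex\<close>).

  A stratum is the product of the symmetric powers of the three pieces. The map from tuples to
  multisets is open, and near an ordered tuple \<open>(x, y, z)\<close> with entries \<open>x\<close> in \<open>\<Omega>\<^sub>s\<close>, \<open>y\<close> in
  \<open>\<Omega>\<^sub>s\<^sub>s\<close>, \<open>z\<close> in \<open>\<Omega>\<^sub>u\<^sub>n\<close> every tuple of the same stratum is ordered by type in the same way: the
  entries of \<open>x\<close> and \<open>z\<close> keep their type because \<open>\<Omega>\<^sub>s\<close> and \<open>\<Omega>\<^sub>u\<^sub>n\<close> are open, and then counting leaves
  no freedom for those of \<open>y\<close> (\<open>stratum_homeomorphic_space_prod_sym_product\<close>). The symmetric power
  of the plane is a Euclidean space, since a monic polynomial is determined by its roots as well as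
  by its coefficients and large roots force large coefficients
  (\<open>sym_product_complex_homeomorphic_space_Euclidean_space\<close>).

  What remains is the symmetric power of the circle. Lift \<open>l\<close> points of the circle to a
  nondecreasing sequence \<open>u\<close> of reals indexed by the integers with \<open>u (i + l) = u i + 1\<close>. The lift is unique up
  to a shift of the index, and a shift by one adds \<open>1\<close> to \<open>u 0 + \<dots> + u (l - 1)\<close>. The sum \<open>s\<close>
  and the \<open>l\<close> nonnegative gaps, which add up to \<open>1\<close>, determine \<open>u\<close>. So the symmetric power is the
  quotient of \<open>[0, 1] \<times> \<Delta>\<close>, with \<open>\<Delta>\<close> the \<open>(l - 1)\<close>-simplex of gaps, in which the two ends are
  identified by a cyclic permutation of the vertices of \<open>\<Delta>\<close>.

  The cyclic permutation is made trivial, or a reflection, by coordinates that rotate along with \<open>s\<close>. In the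
  discrete Fourier transform of the gaps it rotates the plane of the frequencies \<open>k\<close> and \<open>l - k\<close>
  by a fixed angle. Twisting the \<open>k\<close>-th mode with a phase linear in \<open>s\<close> undoes the rotation as \<open>s\<close> runs from \<open>0\<close> to \<open>1\<close>.
  Only the frequency \<open>l / 2\<close>, a line that exists for even \<open>l\<close>, cannot be untwisted: there the
  permutation is the reflection \<open>-1\<close> (\<open>transform_cyclic_shift\<close>). A radial map, built from the gauge
  of the simplex and hence compatible with the permutation, carries the simplex to the round disc.
  This gives the product for odd \<open>l\<close> and the nonorientable bundle for even \<open>l\<close>
  (\<open>sym_product_circle_homeomorphic_space_glued_cylinder\<close>). Everything
  happens on a compact fundamental domain, so the inverse maps are continuous for free.
\<close>

section \<open>Quotient maps and products of topologies\<close>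

lemma quotient_maps_same_fibres_imp_homeomorphic_space:
  assumes f: "quotient_map X Y f" and g: "quotient_map X Z g"
    and fibres: "\<And>x y. x \<in> topspace X \<Longrightarrow> y \<in> topspace X \<Longrightarrow> f x = f y \<longleftrightarrow> g x = g y"
  shows "Y homeomorphic_space Z"
proof -
  obtain h where h: "continuous_map Y Z h" "h ` topspace Y = g ` topspace X"
      "\<And>x. x \<in> topspace X \<Longrightarrow> h (f x) = g x"
    using quotient_map_lift_exists[OF f quotient_imp_continuous_map[OF g]] fibres by metis
  obtain h' where h': "continuous_map Z Y h'" "h' ` topspace Z = f ` topspace X"
      "\<And>x. x \<in> topspace X \<Longrightarrow> h' (g x) = f x"
    using quotient_map_lift_exists[OF g quotient_imp_continuous_map[OF f]] fibres by metis
  have "topspace Y = f ` topspace X" "topspace Z = g ` topspace X"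
    using f g by (auto simp: quotient_imp_surjective_map)
  then have "homeomorphic_maps Y Z h h'"
    unfolding homeomorphic_maps_def using h h' by auto
  then show ?thesis
    unfolding homeomorphic_space_def by blast
qed

lemma open_map_prod:
  assumes "open_map X X' f" "open_map Y Y' g"
  shows "open_map (prod_topology X Y) (prod_topology X' Y') (\<lambda>(x, y). (f x, g y))"
  unfolding open_map_def
proof (intro allI impI)
  fix U assume U: "openin (prod_topology X Y) U"
  show "openin (prod_topology X' Y') ((\<lambda>(x, y). (f x, g y)) ` U)"
    unfolding openin_prod_topology_alt
  proof (intro allI impI)
    fix a b assume "(a, b) \<in> (\<lambda>(x, y). (f x, g y)) ` U"
    then obtain x y where xy: "(x, y) \<in> U" "a = f x" "b = g y" by auto
    then obtain V W where "openin X V" "openin Y W" "x \<in> V" "y \<in> W" "V \<times> W \<subseteq> U"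
      using U unfolding openin_prod_topology_alt by meson
    with xy assms show "\<exists>V W. openin X' V \<and> openin Y' W \<and> a \<in> V \<and> b \<in> W \<and>
        V \<times> W \<subseteq> (\<lambda>(x, y). (f x, g y)) ` U"
      unfolding open_map_def by (intro exI[of _ "f ` V"] exI[of _ "g ` W"]) fastforce
  qed
qed

lemma homeomorphic_space_prod_topology_assoc:
  "prod_topology (prod_topology X Y) Z homeomorphic_space prod_topology X (prod_topology Y Z)"
proof -
  have "homeomorphic_maps (prod_topology (prod_topology X Y) Z) (prod_topology X (prod_topology Y Z))
      (\<lambda>p. (fst (fst p), (snd (fst p), snd p))) (\<lambda>p. ((fst p, fst (snd p)), snd (snd p)))"
    unfolding homeomorphic_maps_def
    by (intro conjI continuous_map_pairedI continuous_map_fst continuous_map_snd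
          continuous_map_compose[OF continuous_map_fst continuous_map_fst, unfolded o_def]
          continuous_map_compose[OF continuous_map_fst continuous_map_snd, unfolded o_def]
          continuous_map_compose[OF continuous_map_snd continuous_map_fst, unfolded o_def]
          continuous_map_compose[OF continuous_map_snd continuous_map_snd, unfolded o_def]) auto
  then show ?thesis
    unfolding homeomorphic_space_def by blast
qed

section \<open>Symmetric products\<close>

abbreviation tuple_mset :: "nat \<Rightarrow> (nat \<Rightarrow> 'a) \<Rightarrow> 'a multiset" where
  "tuple_mset n \<equiv> (\<lambda>x. image_mset x (mset_set {..<n}))"

abbreviation power_topology :: "'a topology \<Rightarrow> nat \<Rightarrow> (nat \<Rightarrow> 'a) topology" where
  "power_topology X n \<equiv> product_topology (\<lambda>_. X) {..<n}"

lemma tuple_mset_cong: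
  "(\<And>i. i < n \<Longrightarrow> x i = y i) \<Longrightarrow> tuple_mset n x = tuple_mset n y"
  by (intro image_mset_cong) auto

lemma tuple_mset_nth: "tuple_mset (length xs) (\<lambda>i. xs ! i) = mset xs"
  by (metis atLeast_upt map_nth mset_map mset_set_upto_eq_mset_upto)

lemma tuple_mset_add: "tuple_mset (a + b) x = tuple_mset a x + tuple_mset b (\<lambda>i. x (a + i))"
  by (induction b) (auto simp: lessThan_Suc)

lemma ex_tuple_mset:
  obtains x where "x \<in> extensional {..<size M}" "tuple_mset (size M) x = M"
proof -
  obtain xs where xs: "mset xs = M" using ex_mset by blast
  then have "tuple_mset (size M) (restrict (\<lambda>i. xs ! i) {..<size M}) = M"
    using tuple_mset_nth[of xs] tuple_mset_cong[of "size M" "restrict (\<lambda>i. xs ! i) {..<size M}" "\<lambda>i. xs ! i"]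
    by auto
  then show thesis by (intro that[of "restrict (\<lambda>i. xs ! i) {..<size M}"]) auto
qed

lemma quotient_map_tuple_mset:
  "quotient_map (power_topology X n) (sym_product X n) (tuple_mset n)"
  unfolding sym_product_def by (rule quotient_map_quotient_topology)

lemma topspace_sym_product:
  "topspace (sym_product X n) = {M. size M = n \<and> set_mset M \<subseteq> topspace X}"
proof -
  have "M \<in> tuple_mset n ` topspace (power_topology X n)"
    if M: "size M = n" "set_mset M \<subseteq> topspace X" for M
  proof -
    obtain x where x: "x \<in> extensional {..<n}" "tuple_mset n x = M"
      using ex_tuple_mset[of M] M by blast
    have "x i \<in> topspace X" if "i < n" for i
    proof -
      have "x i \<in># tuple_mset n x" using that by auto
      then show ?thesis using x M by auto
    qed
    with x show ?thesis
      by (intro image_eqI[of _ _ x]) (auto simp: PiE_def)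
  qed
  then show ?thesis
    by (auto simp: sym_product_def PiE_def Pi_def)
qed

text \<open>
  Two tuples have the same multiset of entries iff they differ by a permutation of the indices, so
  the saturation of a set is the union of its finitely many translates. It is therefore open or closed
  if the set is, which makes the projection to the symmetric product both an open and a closed map.
\<close>

lemma tuple_mset_saturation:
  assumes "U \<subseteq> topspace (power_topology X n)"
  shows "{x \<in> topspace (power_topology X n). tuple_mset n x \<in> tuple_mset n ` U} =
    (\<Union>p\<in>{p. p permutes {..<n}}.
       {x \<in> topspace (power_topology X n). restrict (\<lambda>i. x (p i)) {..<n} \<in> U})"
proof (intro equalityI subsetI)
  fix x assume x: "x \<in> {x \<in> topspace (power_topology X n). tuple_mset n x \<in> tuple_mset n ` U}"
  then obtain u where u: "u \<in> U" "tuple_mset n u = tuple_mset n x" by auto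
  then obtain p where p: "p permutes {..<n}" "\<forall>i\<in>{..<n}. u i = x (p i)"
    using image_mset_eq_implies_permutes[of "{..<n}" u x] by auto
  have "u \<in> extensional {..<n}"
    using u(1) assms by (auto simp: PiE_def)
  then have "restrict (\<lambda>i. x (p i)) {..<n} = u"
    using p(2) by (auto simp: restrict_def extensional_def)
  then show "x \<in> (\<Union>p\<in>{p. p permutes {..<n}}.
       {x \<in> topspace (power_topology X n). restrict (\<lambda>i. x (p i)) {..<n} \<in> U})"
    using p(1) u(1) x by auto
next
  fix x assume "x \<in> (\<Union>p\<in>{p. p permutes {..<n}}.
       {x \<in> topspace (power_topology X n). restrict (\<lambda>i. x (p i)) {..<n} \<in> U})"
  then obtain p where p: "p permutes {..<n}" and x: "x \<in> topspace (power_topology X n)"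
    "restrict (\<lambda>i. x (p i)) {..<n} \<in> U" by auto
  have "tuple_mset n (restrict (\<lambda>i. x (p i)) {..<n}) = image_mset x (image_mset p (mset_set {..<n}))"
    unfolding multiset.map_comp by (rule tuple_mset_cong) simp
  also have "\<dots> = tuple_mset n x"
    using p by (simp add: permutes_image_mset)
  finally show "x \<in> {x \<in> topspace (power_topology X n). tuple_mset n x \<in> tuple_mset n ` U}"
    using x by (auto intro: rev_image_eqI)
qed

lemma continuous_map_permute_coordinates:
  assumes "p permutes {..<n}"
  shows "continuous_map (power_topology X n) (power_topology X n) (\<lambda>x. restrict (\<lambda>i. x (p i)) {..<n})"
  using permutes_in_image[OF assms]
  by (auto simp: continuous_map_componentwise intro!: continuous_map_product_projection)

lemma open_map_tuple_mset: "open_map (power_topology X n) (sym_product X n) (tuple_mset n)"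
  unfolding open_map_def
proof (intro allI impI)
  fix U assume U: "openin (power_topology X n) U"
  have "openin (power_topology X n)
      {x \<in> topspace (power_topology X n). tuple_mset n x \<in> tuple_mset n ` U}"
    unfolding tuple_mset_saturation[OF openin_subset[OF U]]
    using U
    by (intro openin_Union)
       (blast intro: openin_continuous_map_preimage[OF continuous_map_permute_coordinates])
  then show "openin (sym_product X n) (tuple_mset n ` U)"
    unfolding sym_product_def openin_quotient_topology
    using openin_subset[OF U] by auto
qed

lemma closed_map_tuple_mset: "closed_map (power_topology X n) (sym_product X n) (tuple_mset n)"
  unfolding closed_map_def
proof (intro allI impI)
  fix U assume U: "closedin (power_topology X n) U"
  have "closedin (power_topology X n)
      {x \<in> topspace (power_topology X n). tuple_mset n x \<in> tuple_mset n ` U}"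
    unfolding tuple_mset_saturation[OF closedin_subset[OF U]]
    using U finite_permutations[of "{..<n}"]
    by (intro closedin_Union)
       (blast intro: closedin_continuous_map_preimage[OF continuous_map_permute_coordinates])+
  moreover have "tuple_mset n ` U \<subseteq> topspace (sym_product X n)"
    unfolding sym_product_def using closedin_subset[OF U] by auto
  ultimately show "closedin (sym_product X n) (tuple_mset n ` U)"
    using quotient_map_tuple_mset[of X n] unfolding quotient_map_closedin by blast
qed

lemma continuous_map_sym_product_image:
  assumes "continuous_map X Y f"
  shows "continuous_map (sym_product X n) (sym_product Y n) (image_mset f)"
proof (rule continuous_compose_quotient_map[OF quotient_map_tuple_mset])
  have "continuous_map (power_topology X n) (power_topology Y n) (\<lambda>x. restrict (\<lambda>i. f (x i)) {..<n})"
    using assms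
    by (auto simp: continuous_map_componentwise
        intro!: continuous_map_compose[of _ X, unfolded o_def] continuous_map_product_projection)
  then have "continuous_map (power_topology X n) (sym_product Y n)
      (tuple_mset n \<circ> (\<lambda>x. restrict (\<lambda>i. f (x i)) {..<n}))"
    using quotient_imp_continuous_map[OF quotient_map_tuple_mset] by (rule continuous_map_compose)
  moreover have "tuple_mset n \<circ> (\<lambda>x. restrict (\<lambda>i. f (x i)) {..<n}) = image_mset f \<circ> tuple_mset n"
    by (auto simp: multiset.map_comp fun_eq_iff intro!: image_mset_cong)
  ultimately show "continuous_map (power_topology X n) (sym_product Y n) (image_mset f \<circ> tuple_mset n)"
    by simp
qed

lemma homeomorphic_space_sym_product:
  assumes "X homeomorphic_space Y"
  shows "sym_product X n homeomorphic_space sym_product Y n"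
proof -
  obtain f g where fg: "homeomorphic_maps X Y f g"
    using assms unfolding homeomorphic_space_def by blast
  have "image_mset g (image_mset f M) = M" if "M \<in> topspace (sym_product X n)" for M
    using that fg unfolding topspace_sym_product homeomorphic_maps_def
    by (auto simp: multiset.map_comp intro!: multiset.map_ident_strong)
  moreover have "image_mset f (image_mset g M) = M" if "M \<in> topspace (sym_product Y n)" for M
    using that fg unfolding topspace_sym_product homeomorphic_maps_def
    by (auto simp: multiset.map_comp intro!: multiset.map_ident_strong)
  ultimately have "homeomorphic_maps (sym_product X n) (sym_product Y n) (image_mset f) (image_mset g)"
    using fg unfolding homeomorphic_maps_def by (auto intro: continuous_map_sym_product_image)
  then show ?thesis
    unfolding homeomorphic_space_def by blast
qed

lemma size_filter_mset_eq_size_imp: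
  assumes "size (filter_mset P M) = size M" "x \<in># M"
  shows "P x"
proof -
  have "filter_mset P M = M"
    using assms(1) multiset_filter_subset[of P M] by (metis mset_subset_size nat_less_le subset_mset.le_less)
  then show ?thesis using assms(2) by (metis filter_mset_eq_conv)
qed

section \<open>Splitting a stratum by type\<close>

definition concat3 :: "nat \<Rightarrow> nat \<Rightarrow> nat \<Rightarrow> (nat \<Rightarrow> 'a) \<times> (nat \<Rightarrow> 'a) \<times> (nat \<Rightarrow> 'a) \<Rightarrow> nat \<Rightarrow> 'a" where
  "concat3 k l m p = (\<lambda>i\<in>{..<k + l + m}. if i < k then fst p i
     else if i < k + l then fst (snd p) (i - k) else snd (snd p) (i - (k + l)))"

definition split3 :: "nat \<Rightarrow> nat \<Rightarrow> nat \<Rightarrow> (nat \<Rightarrow> 'a) \<Rightarrow> (nat \<Rightarrow> 'a) \<times> (nat \<Rightarrow> 'a) \<times> (nat \<Rightarrow> 'a)" where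
  "split3 k l m x = (\<lambda>i\<in>{..<k}. x i, \<lambda>i\<in>{..<l}. x (k + i), \<lambda>i\<in>{..<m}. x (k + l + i))"

lemma tuple_mset_concat3:
  "tuple_mset (k + l + m) (concat3 k l m (x, y, z)) = tuple_mset k x + tuple_mset l y + tuple_mset m z"
  unfolding tuple_mset_add
  by (intro arg_cong2[where f = "(+)"] tuple_mset_cong) (auto simp: concat3_def)

lemma homeomorphic_maps_concat3:
  fixes X :: "'a topology" and A B C :: "'a set" and k l m :: nat
  defines "P \<equiv> {x \<in> topspace (power_topology X (k + l + m)).
      (\<forall>i<k. x i \<in> A) \<and> (\<forall>i<l. x (k + i) \<in> B) \<and> (\<forall>i<m. x (k + l + i) \<in> C)}"
  shows "homeomorphic_maps
     (prod_topology (power_topology (subtopology X A) k)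
       (prod_topology (power_topology (subtopology X B) l) (power_topology (subtopology X C) m)))
     (subtopology (power_topology X (k + l + m)) (P))
     (concat3 k l m) (split3 k l m)"
proof -
  let ?T = "prod_topology (power_topology (subtopology X A) k)
       (prod_topology (power_topology (subtopology X B) l) (power_topology (subtopology X C) m))"
  have proj: "continuous_map (power_topology (subtopology X D) n) X (\<lambda>x. x i)" if "i < n" for D n i
    using continuous_map_product_projection[of i "{..<n}" "\<lambda>_. subtopology X D"] that
    by (auto simp: continuous_map_in_subtopology)
  have c1: "continuous_map ?T X (\<lambda>p. fst p i)" if "i < k" for i
    using continuous_map_compose[OF continuous_map_fst proj[OF that]] by (simp add: o_def)
  have c2: "continuous_map ?T X (\<lambda>p. fst (snd p) i)" if "i < l" for i
    using continuous_map_compose[OF continuous_map_snd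
        continuous_map_compose[OF continuous_map_fst proj[OF that]]] by (simp add: o_def)
  have c3: "continuous_map ?T X (\<lambda>p. snd (snd p) i)" if "i < m" for i
    using continuous_map_compose[OF continuous_map_snd
        continuous_map_compose[OF continuous_map_snd proj[OF that]]] by (simp add: o_def)
  have "continuous_map ?T X (\<lambda>p. concat3 k l m p i)" if "i < k + l + m" for i
    using that c1[of i] c2[of "i - k"] c3[of "i - (k + l)"]
    by (cases "i < k"; cases "i < k + l") (auto simp: concat3_def)
  then have "continuous_map ?T (power_topology X (k + l + m)) (concat3 k l m)"
    by (auto simp: continuous_map_componentwise concat3_def)
  moreover have "concat3 k l m p \<in> P" if "p \<in> topspace ?T" for p
    using that by (auto simp: P_def concat3_def PiE_def Pi_def)
  ultimately have 1: "continuous_map ?T (subtopology (power_topology X (k + l + m)) (P)) (concat3 k l m)"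
    by (auto simp: continuous_map_in_subtopology)
  have cr: "continuous_map (subtopology (power_topology X (k + l + m)) (P))
      (power_topology (subtopology X D) n) (\<lambda>x. \<lambda>i\<in>{..<n}. x (j + i))"
    if "\<And>x i. x \<in> P \<Longrightarrow> i < n \<Longrightarrow> x (j + i) \<in> D" "j + n \<le> k + l + m" for D n j
    using that
    by (auto simp: continuous_map_componentwise continuous_map_in_subtopology
        intro!: continuous_map_from_subtopology continuous_map_product_projection)
  have 2: "continuous_map (subtopology (power_topology X (k + l + m)) (P)) ?T (split3 k l m)"
    unfolding split3_def using cr[of k 0 A] cr[of l k B] cr[of m "k + l" C]
    by (intro continuous_map_pairedI) (auto simp: P_def)
  have "split3 k l m (concat3 k l m p) = p" if "p \<in> topspace ?T" for p
    using that by (auto simp: split3_def concat3_def PiE_def extensional_def fun_eq_iff)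
  moreover have "concat3 k l m (split3 k l m x) = x"
    if "x \<in> topspace (subtopology (power_topology X (k + l + m)) (P))" for x
    using that by (auto simp: split3_def concat3_def PiE_def extensional_def fun_eq_iff)
  ultimately show ?thesis
    unfolding homeomorphic_maps_def using 1 2 by blast
qed

text \<open>
  The product of the three tuple spaces has two quotient maps with the same fibres: one to the stratum,
  by concatenation, and one to the product of the symmetric powers. The first is open because the tuples
  ordered by type form an open subset \<open>P0\<close> of the set \<open>Q\<close> of all tuples over the stratum: the
  conditions on the entries in \<open>A\<close> and \<open>C\<close> are open, and they force the others to lie in \<open>B\<close>.
\<close>

lemma stratum_homeomorphic_space_prod_sym_product:
  fixes X :: "'a topology" and A B C :: "'a set" and k l m :: nat
  assumes A: "openin X A" and C: "openin X C" and B: "B \<subseteq> topspace X"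
    and disj: "A \<inter> B = {}" "A \<inter> C = {}" "B \<inter> C = {}"
  defines "S \<equiv> {M \<in> topspace (sym_product X (k + l + m)). size (filter_mset (\<lambda>z. z \<in> A) M) = k \<and>
      size (filter_mset (\<lambda>z. z \<in> B) M) = l \<and> size (filter_mset (\<lambda>z. z \<in> C) M) = m}"
  shows "subtopology (sym_product X (k + l + m)) S homeomorphic_space
    prod_topology (sym_product (subtopology X A) k)
      (prod_topology (sym_product (subtopology X B) l) (sym_product (subtopology X C) m))"
proof -
  let ?n = "k + l + m"
  define q :: "(nat \<Rightarrow> 'a) \<Rightarrow> 'a multiset" where "q = tuple_mset (k + l + m)"
  define PX where "PX = power_topology X (k + l + m)"
  let ?TA = "power_topology (subtopology X A) k"
  let ?TB = "power_topology (subtopology X B) l"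
  let ?TC = "power_topology (subtopology X C) m"
  let ?T = "prod_topology ?TA (prod_topology ?TB ?TC)"
  define P0 where "P0 = {x \<in> topspace PX.
      (\<forall>i<k. x i \<in> A) \<and> (\<forall>i<l. x (k + i) \<in> B) \<and> (\<forall>i<m. x (k + l + i) \<in> C)}"
  define Q where "Q = {x \<in> topspace PX. q x \<in> S}"
  define W where "W = {x \<in> topspace PX. (\<forall>i<k. x i \<in> A) \<and> (\<forall>i<m. x (k + l + i) \<in> C)}"
  have subs: "A \<subseteq> topspace X" "C \<subseteq> topspace X" using A C openin_subset by auto
  have none: "filter_mset (\<lambda>z. z \<in> D) M = {#}" if "set_mset M \<subseteq> E" "D \<inter> E = {}" for D E and M :: "'a multiset"
    using that by (induction M) auto
  have all: "filter_mset (\<lambda>z. z \<in> D) M = M" if "set_mset M \<subseteq> D" for D and M :: "'a multiset"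
    using that by (auto simp: filter_mset_eq_conv)
  have filters: "filter_mset (\<lambda>z. z \<in> A) (M + N + L) = M" "filter_mset (\<lambda>z. z \<in> B) (M + N + L) = N"
      "filter_mset (\<lambda>z. z \<in> C) (M + N + L) = L"
    if "set_mset M \<subseteq> A" "set_mset N \<subseteq> B" "set_mset L \<subseteq> C" for M N L
    using that disj by (simp_all add: all none[of _ A] none[of _ B] none[of _ C] Int_commute)
  have qsplit: "q x = tuple_mset k x + tuple_mset l (\<lambda>i. x (k + i)) + tuple_mset m (\<lambda>i. x (k + l + i))" for x
    unfolding q_def tuple_mset_add by simp
  \<comment> \<open>Over the stratum, membership in \<open>B\<close> follows by counting from membership in \<open>A\<close> and \<open>C\<close>.\<close>
  have "P0 = Q \<inter> W"
  proof (intro equalityI subsetI)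
    fix x assume x: "x \<in> P0"
    then have "set_mset (tuple_mset k x) \<subseteq> A" "set_mset (tuple_mset l (\<lambda>i. x (k + i))) \<subseteq> B"
      "set_mset (tuple_mset m (\<lambda>i. x (k + l + i))) \<subseteq> C"
      by (auto simp: P0_def)
    from filters[OF this] have "q x \<in> S"
      using x quotient_imp_surjective_map[OF quotient_map_tuple_mset[of X ?n]]
      by (auto simp: S_def qsplit[symmetric] P0_def PX_def q_def simp del: topspace_product_topology)
    then show "x \<in> Q \<inter> W" using x by (auto simp: Q_def W_def P0_def)
  next
    fix x assume x: "x \<in> Q \<inter> W"
    let ?M = "tuple_mset k x" and ?N = "tuple_mset l (\<lambda>i. x (k + i))" and ?L = "tuple_mset m (\<lambda>i. x (k + l + i))"
    have "set_mset ?M \<subseteq> A" "set_mset ?L \<subseteq> C"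
      using x by (auto simp: W_def)
    then have "filter_mset (\<lambda>z. z \<in> B) (q x) = filter_mset (\<lambda>z. z \<in> B) ?N"
      using disj none[of ?M A B] none[of ?L C B] by (simp add: qsplit Int_commute)
    then have "size (filter_mset (\<lambda>z. z \<in> B) ?N) = size ?N"
      using x by (auto simp: Q_def S_def)
    from size_filter_mset_eq_size_imp[OF this] show "x \<in> P0"
      using x by (auto simp: P0_def W_def)
  qed
  moreover have "openin PX W"
  proof -
    have "openin PX {x \<in> topspace PX. x i \<in> D}" if "openin X D" "i < ?n" for D i
      unfolding PX_def using that
      by (intro openin_continuous_map_preimage[OF continuous_map_product_projection]) auto
    then have "openin PX (topspace PX \<inter> (\<Inter>i<k. {x \<in> topspace PX. x i \<in> A})
        \<inter> (\<Inter>i<m. {x \<in> topspace PX. x (k + l + i) \<in> C}))"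
      using A C by (cases "k = 0"; cases "m = 0") (auto intro!: openin_Int openin_INT2)
    moreover have "topspace PX \<inter> (\<Inter>i<k. {x \<in> topspace PX. x i \<in> A})
        \<inter> (\<Inter>i<m. {x \<in> topspace PX. x (k + l + i) \<in> C}) = W"
      by (auto simp: W_def)
    ultimately show ?thesis by simp
  qed
  ultimately have P0_open: "openin (subtopology PX Q) P0"
    by (auto simp: openin_subtopology)
  have "open_map (subtopology PX Q) (subtopology (sym_product X ?n) S) q"
    using open_map_restriction[OF open_map_tuple_mset[of X ?n], of S Q]
    by (simp add: PX_def q_def Q_def)
  from open_map_from_subtopology[OF this P0_open]
  have open_q: "open_map (subtopology PX P0) (subtopology (sym_product X ?n) S) q"
    using \<open>P0 = Q \<inter> W\<close> by (simp add: subtopology_subtopology)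
  have hm: "homeomorphic_maps ?T (subtopology PX P0) (concat3 k l m) (split3 k l m)"
    unfolding PX_def P0_def by (rule homeomorphic_maps_concat3)
  then have "homeomorphic_map ?T (subtopology PX P0) (concat3 k l m)"
    unfolding homeomorphic_map_maps by blast
  then have open_concat: "open_map ?T (subtopology PX P0) (concat3 k l m)"
    and cont_concat: "continuous_map ?T (subtopology PX P0) (concat3 k l m)"
    by (rule homeomorphic_imp_open_map, rule homeomorphic_imp_continuous_map)
  have cont_q: "continuous_map (subtopology PX P0) (subtopology (sym_product X ?n) S) q"
    using quotient_imp_continuous_map[OF quotient_map_tuple_mset[of X ?n]] \<open>P0 = Q \<inter> W\<close>
    by (auto simp: continuous_map_in_subtopology continuous_map_from_subtopology PX_def q_def Q_def)
  have qc: "q (concat3 k l m (x, y, z)) = tuple_mset k x + tuple_mset l y + tuple_mset m z" for x y z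
    unfolding q_def by (rule tuple_mset_concat3)
  have surj: "(q \<circ> concat3 k l m) ` topspace ?T = topspace (subtopology (sym_product X ?n) S)"
  proof
    show "(q \<circ> concat3 k l m) ` topspace ?T \<subseteq> topspace (subtopology (sym_product X ?n) S)"
      using continuous_map_image_subset_topspace[OF continuous_map_compose[OF cont_concat cont_q]] .
    show "topspace (subtopology (sym_product X ?n) S) \<subseteq> (q \<circ> concat3 k l m) ` topspace ?T"
    proof
      fix M assume "M \<in> topspace (subtopology (sym_product X ?n) S)"
      then have M: "M \<in> S" by simp
      let ?A = "filter_mset (\<lambda>z. z \<in> A) M" and ?B = "filter_mset (\<lambda>z. z \<in> B) M" and ?C = "filter_mset (\<lambda>z. z \<in> C) M"
      have "?A + ?B + ?C \<subseteq># M"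
        using disj by (auto simp: subseteq_mset_def)
      moreover have "size (?A + ?B + ?C) = size M"
        using M by (simp add: S_def topspace_sym_product)
      ultimately have eq: "?A + ?B + ?C = M"
        by (metis mset_subset_size nat_less_le subset_mset.le_less)
      have ex: "\<exists>x \<in> topspace (power_topology (subtopology X D) n). tuple_mset n x = N"
        if "N \<in> topspace (sym_product (subtopology X D) n)" for D n N
        using that quotient_imp_surjective_map[OF quotient_map_tuple_mset[of "subtopology X D" n]]
        by (metis (no_types, lifting) imageE)
      have "set_mset M \<subseteq> topspace X" using M by (simp add: S_def topspace_sym_product)
      then have "?A \<in> topspace (sym_product (subtopology X A) k)"
        "?B \<in> topspace (sym_product (subtopology X B) l)"
        "?C \<in> topspace (sym_product (subtopology X C) m)"
        using M by (auto simp: S_def topspace_sym_product)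
      then obtain x y z where "x \<in> topspace ?TA" "tuple_mset k x = ?A"
        "y \<in> topspace ?TB" "tuple_mset l y = ?B" "z \<in> topspace ?TC" "tuple_mset m z = ?C"
        using ex by meson
      then show "M \<in> (q \<circ> concat3 k l m) ` topspace ?T"
        using eq by (intro image_eqI[of _ _ "(x, y, z)"]) (simp_all add: qc)
    qed
  qed
  have "quotient_map ?T (subtopology (sym_product X ?n) S) (q \<circ> concat3 k l m)"
    using continuous_map_compose[OF cont_concat cont_q] open_map_compose[OF open_concat open_q] surj
    by (rule continuous_open_imp_quotient_map)
  moreover
  let ?r = "\<lambda>(x, p). (tuple_mset k x, (\<lambda>(y, z). (tuple_mset l y, tuple_mset m z)) p)"
  have "quotient_map ?T (prod_topology (sym_product (subtopology X A) k)
      (prod_topology (sym_product (subtopology X B) l) (sym_product (subtopology X C) m))) ?r"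
  proof (rule continuous_open_imp_quotient_map)
    show "open_map ?T (prod_topology (sym_product (subtopology X A) k)
      (prod_topology (sym_product (subtopology X B) l) (sym_product (subtopology X C) m))) ?r"
      by (intro open_map_prod open_map_tuple_mset)
    have s: "tuple_mset n ` topspace (power_topology (subtopology X D) n) = topspace (sym_product (subtopology X D) n)" for D n
      using quotient_map_tuple_mset quotient_imp_surjective_map by blast
    show "?r ` topspace ?T = topspace (prod_topology (sym_product (subtopology X A) k)
      (prod_topology (sym_product (subtopology X B) l) (sym_product (subtopology X C) m)))"
      unfolding topspace_prod_topology
      by (intro map_prod_surj_on[unfolded map_prod_def] s)
    have c: "continuous_map (power_topology (subtopology X D) n) (sym_product (subtopology X D) n) (tuple_mset n)" for D n
      using quotient_map_tuple_mset quotient_imp_continuous_map by blast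
    show "continuous_map ?T (prod_topology (sym_product (subtopology X A) k)
      (prod_topology (sym_product (subtopology X B) l) (sym_product (subtopology X C) m))) ?r"
      by (intro continuous_map_prod_top[THEN iffD2] disjI2 conjI c)
  qed
  moreover have "(q \<circ> concat3 k l m) p = (q \<circ> concat3 k l m) p' \<longleftrightarrow> ?r p = ?r p'"
    if "p \<in> topspace ?T" "p' \<in> topspace ?T" for p p'
  proof -
    obtain x y z x' y' z' where p: "p = (x, y, z)" "p' = (x', y', z')"
      by (metis surj_pair)
    have *: "set_mset (tuple_mset k x) \<subseteq> A" "set_mset (tuple_mset l y) \<subseteq> B" "set_mset (tuple_mset m z) \<subseteq> C"
      "set_mset (tuple_mset k x') \<subseteq> A" "set_mset (tuple_mset l y') \<subseteq> B" "set_mset (tuple_mset m z') \<subseteq> C"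
      using that by (auto simp: p PiE_def Pi_def)
    then show ?thesis
      using filters[OF *(1-3)] filters[OF *(4-6)] unfolding p o_def qc prod.case prod.inject
      by (metis (no_types, lifting))
  qed
  ultimately show ?thesis
    by (rule quotient_maps_same_fibres_imp_homeomorphic_space)
qed

section \<open>The symmetric product of the plane\<close>

lemma continuous_map_Euclidean_space_coordinate:
  "continuous_map (Euclidean_space n) euclideanreal (\<lambda>x. x i)"
  unfolding Euclidean_space_def
  using continuous_map_product_projection[of i UNIV "\<lambda>_. euclideanreal"]
  by (intro continuous_map_from_subtopology) auto

lemma continuous_map_into_Euclidean_space:
  assumes "\<And>i. i < n \<Longrightarrow> continuous_map X euclideanreal (\<lambda>x. f x i)"
    and "\<And>x i. x \<in> topspace X \<Longrightarrow> i \<ge> n \<Longrightarrow> f x i = 0"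
  shows "continuous_map X (Euclidean_space n) f"
proof -
  have "continuous_map X (Euclidean_space n) (\<lambda>x i. if i < n then f x i else 0)"
    using assms(1) by (simp add: continuous_map_componentwise_Euclidean_space)
  then show ?thesis
    by (rule continuous_map_eq) (use assms(2) in \<open>auto simp: fun_eq_iff not_less\<close>)
qed

lemma homeomorphic_space_prod_Euclidean_space:
  "prod_topology (Euclidean_space a) (Euclidean_space b) homeomorphic_space Euclidean_space (a + b)"
proof -
  let ?f = "\<lambda>(x, y) i. if i < a then x i else y (i - a) :: real"
  let ?g = "\<lambda>z. (\<lambda>i. if i < a then z i else 0, \<lambda>i. z (a + i))"
  have "continuous_map (prod_topology (Euclidean_space a) (Euclidean_space b)) euclideanreal
      (\<lambda>p. ?f p i)" for i
    using continuous_map_compose[OF continuous_map_fst continuous_map_Euclidean_space_coordinate]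
      continuous_map_compose[OF continuous_map_snd continuous_map_Euclidean_space_coordinate]
    by (cases "i < a") (auto simp: case_prod_beta o_def)
  then have "continuous_map (prod_topology (Euclidean_space a) (Euclidean_space b))
      (Euclidean_space (a + b)) ?f"
    by (rule continuous_map_into_Euclidean_space) (auto simp: topspace_Euclidean_space)
  moreover have "continuous_map (Euclidean_space (a + b))
      (prod_topology (Euclidean_space a) (Euclidean_space b)) ?g"
    by (intro continuous_map_pairedI continuous_map_into_Euclidean_space)
      (auto simp: topspace_Euclidean_space continuous_map_Euclidean_space_coordinate)
  ultimately have "homeomorphic_maps (prod_topology (Euclidean_space a) (Euclidean_space b))
      (Euclidean_space (a + b)) ?f ?g"
    unfolding homeomorphic_maps_def by (auto simp: topspace_Euclidean_space fun_eq_iff)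
  then show ?thesis
    unfolding homeomorphic_space_def by blast
qed

lemma power_topology_complex_homeomorphic_space_Euclidean_space:
  "power_topology (euclidean :: complex topology) n homeomorphic_space Euclidean_space (2 * n)"
proof -
  let ?f = "\<lambda>x i. if i < 2 * n then if even i then Re (x (i div 2)) else Im (x (i div 2)) else 0"
  let ?g = "\<lambda>y. \<lambda>j\<in>{..<n}. Complex (y (2 * j)) (y (2 * j + 1))"
  have "continuous_map (power_topology euclidean n) euclideanreal (\<lambda>x. Re (x j))"
    "continuous_map (power_topology euclidean n) euclideanreal (\<lambda>x. Im (x j))"
    if "j < n" for j
  proof -
    have "continuous_map (power_topology euclidean n) (euclidean :: complex topology) (\<lambda>x. x j)"
      using that by (intro continuous_map_product_projection) auto
    moreover have "continuous_map euclidean euclideanreal Re" "continuous_map euclidean euclideanreal Im"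
      unfolding continuous_map_iff_continuous2 by (intro continuous_intros)+
    ultimately show "continuous_map (power_topology euclidean n) euclideanreal (\<lambda>x. Re (x j))"
      "continuous_map (power_topology euclidean n) euclideanreal (\<lambda>x. Im (x j))"
      by (auto dest: continuous_map_compose simp: o_def simp del: continuous_map_iff_continuous2)
  qed
  then have "continuous_map (power_topology euclidean n) (Euclidean_space (2 * n)) ?f"
    by (intro continuous_map_into_Euclidean_space) (auto split: if_splits)
  moreover have "continuous_map (Euclidean_space (2 * n)) euclidean (\<lambda>y. Complex (y i) (y j))" for i j
  proof -
    have "continuous_map (Euclidean_space (2 * n)) (euclidean :: complex topology) (\<lambda>y. of_real (y i) + \<i> * of_real (y j))"
      using continuous_map_Euclidean_space_coordinate
      unfolding continuous_map_Euclidean_space_iff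
      by (intro continuous_intros) (auto simp: continuous_map_Euclidean_space_iff[symmetric])
    then show ?thesis by (simp add: Complex_eq)
  qed
  then have "continuous_map (Euclidean_space (2 * n)) (power_topology euclidean n) ?g"
    by (auto simp: continuous_map_componentwise)
  moreover have "?g (?f x) = x" if "x \<in> topspace (power_topology euclidean n)" for x
    using that by (auto simp: fun_eq_iff PiE_def extensional_def)
  moreover have "?f (?g y) = y" if "y \<in> topspace (Euclidean_space (2 * n))" for y
    using that by (auto simp: fun_eq_iff topspace_Euclidean_space elim!: evenE oddE)
  ultimately have "homeomorphic_maps (power_topology euclidean n) (Euclidean_space (2 * n)) ?f ?g"
    unfolding homeomorphic_maps_def by blast
  then show ?thesis
    unfolding homeomorphic_space_def by blast
qed

definition root_poly :: "nat \<Rightarrow> (nat \<Rightarrow> complex) \<Rightarrow> complex poly" where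
  "root_poly n x = (\<Prod>j<n. [:- x j, 1:])"

definition vieta :: "nat \<Rightarrow> (nat \<Rightarrow> complex) \<Rightarrow> nat \<Rightarrow> complex" where
  "vieta n x = (\<lambda>i\<in>{..<n}. coeff (root_poly n x) i)"

lemma root_poly_eq_prod_mset: "root_poly n x = (\<Prod>a\<in>#tuple_mset n x. [:- a, 1:])"
  unfolding root_poly_def prod_unfold_prod_mset by (simp add: multiset.map_comp o_def)

lemma proots_root_poly: "proots (root_poly n x) = tuple_mset n x"
proof (induction n)
  case (Suc n)
  have "root_poly n x \<noteq> 0"
    by (auto simp: root_poly_def)
  then have "proots ([:- x n, 1:] * root_poly n x) = {#x n#} + proots (root_poly n x)"
    by (subst proots_mult) auto
  then show ?case
    using Suc by (simp add: root_poly_def lessThan_Suc del: mult_pCons_left)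
qed (simp add: root_poly_def)

lemma degree_root_poly: "degree (root_poly n x) = n"
  unfolding root_poly_def by (subst degree_prod_eq_sum_degree) auto

lemma coeff_root_poly_degree: "coeff (root_poly n x) n = 1"
proof -
  have "lead_coeff (root_poly n x) = 1"
    unfolding root_poly_def by (simp add: lead_coeff_prod)
  then show ?thesis by (simp add: degree_root_poly)
qed

text \<open>
  The values of \<open>vieta\<close> are the non-leading coefficients of the monic polynomial with the given roots,
  and that polynomial determines the multiset of its roots.
\<close>

lemma vieta_eq_iff: "vieta n x = vieta n y \<longleftrightarrow> tuple_mset n x = tuple_mset n y"
proof
  assume eq: "vieta n x = vieta n y"
  have "coeff (root_poly n x) i = coeff (root_poly n y) i" for i
  proof (cases i n rule: linorder_cases)
    case less
    then show ?thesis using fun_cong[OF eq, of i] by (simp add: vieta_def)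
  next
    case equal
    then show ?thesis by (simp add: coeff_root_poly_degree)
  next
    case greater
    then show ?thesis by (simp add: coeff_eq_0 degree_root_poly)
  qed
  then show "tuple_mset n x = tuple_mset n y"
    by (metis poly_eqI proots_root_poly)
qed (simp add: vieta_def root_poly_eq_prod_mset)

lemma vieta_surj:
  assumes "c \<in> extensional {..<n}"
  obtains x where "x \<in> extensional {..<n}" "vieta n x = c"
proof -
  define p where "p = Poly (map c [0..<n] @ [1])"
  have coeff_p: "coeff p i = (if i < n then c i else if i = n then 1 else 0)" for i
    by (auto simp: p_def nth_default_def nth_append)
  have deg: "degree p = n"
    by (rule antisym[OF degree_le le_degree]) (auto simp: coeff_p)
  then have "p \<noteq> 0" "lead_coeff p = 1"
    using coeff_p[of n] by auto
  then obtain A where A: "size A = n" "p = (\<Prod>x\<in>#A. [:- x, 1:])"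
    using alg_closed_imp_factorization[of p] deg by auto
  obtain x where "x \<in> extensional {..<n}" "tuple_mset n x = A"
    using ex_tuple_mset[of A] A by blast
  moreover from this have "root_poly n x = p"
    using A by (simp add: root_poly_eq_prod_mset)
  then have "vieta n x = c"
    using assms by (auto simp: vieta_def coeff_p extensional_def fun_eq_iff)
  ultimately show thesis using that by blast
qed

lemma continuous_map_mult:
  fixes f g :: "'a \<Rightarrow> 'b::real_normed_algebra"
  assumes "continuous_map X euclidean f" "continuous_map X euclidean g"
  shows "continuous_map X euclidean (\<lambda>x. f x * g x)"
proof -
  have "continuous_map X euclidean (\<lambda>x. (f x, g x))"
    using continuous_map_pairedI[OF assms] by simp
  moreover have "continuous_map euclidean euclidean (\<lambda>p::'b \<times> 'b. fst p * snd p)"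
    unfolding continuous_map_iff_continuous2 by (intro continuous_intros)
  ultimately show ?thesis
    using continuous_map_compose by (fastforce simp: o_def simp del: continuous_map_iff_continuous2)
qed

lemma continuous_map_vieta:
  "continuous_map (power_topology euclidean n) (power_topology euclidean n) (vieta n)"
proof -
  have "continuous_map (power_topology euclidean n) euclidean (\<lambda>x. coeff (root_poly m x) i)"
    if "m \<le> n" for m i
    using that
  proof (induction m arbitrary: i)
    case 0
    then show ?case by (simp add: root_poly_def)
  next
    case (Suc m)
    have "coeff (root_poly (Suc m) x) i =
        - x m * coeff (root_poly m x) i + (if i = 0 then 0 else coeff (root_poly m x) (i - 1))" for x
      by (simp add: root_poly_def lessThan_Suc coeff_pCons split: nat.split)
    moreover have "continuous_map (power_topology euclidean n) (euclidean :: complex topology) (\<lambda>x. x m)"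
      using Suc.prems by (intro continuous_map_product_projection) auto
    moreover have "continuous_map (power_topology euclidean n) euclidean
        (\<lambda>x. if i = 0 then 0 else coeff (root_poly m x) (i - 1))"
      using Suc by (cases "i = 0") auto
    moreover have "continuous_map (power_topology euclidean n) euclidean (\<lambda>x. coeff (root_poly m x) i)"
      using Suc by simp
    ultimately show ?case
      by (simp only:) (intro continuous_map_add continuous_map_minus continuous_map_mult)
  qed
  then show ?thesis
    by (auto simp: vieta_def continuous_map_componentwise)
qed

text \<open>
  The classical bound of Cauchy: at a root of modulus larger than \<open>1\<close>, the leading term
  can be balanced by the others only if the moduli of their coefficients add up to at least that modulus.
\<close>

lemma norm_root_le:
  fixes z :: complex
  assumes "z ^ n = - (\<Sum>i<n. c i * z ^ i)"
  shows "norm z \<le> 1 + (\<Sum>i<n. norm (c i))"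
proof (cases "norm z \<le> 1")
  case True
  then show ?thesis by (smt (verit) sum_nonneg norm_ge_zero)
next
  case False
  show ?thesis
  proof (cases n)
    case 0
    then show ?thesis using assms by simp
  next
    case (Suc k)
    have "norm z ^ n \<le> (\<Sum>i<n. norm (c i * z ^ i))"
      using assms by (metis norm_minus_cancel norm_power norm_sum)
    also have "\<dots> \<le> (\<Sum>i<n. norm (c i) * norm z ^ k)"
      using False Suc by (intro sum_mono) (auto simp: norm_mult norm_power intro!: mult_left_mono power_increasing)
    also have "\<dots> = (\<Sum>i<n. norm (c i)) * norm z ^ k"
      by (simp add: sum_distrib_right)
    finally have "norm z * norm z ^ k \<le> (\<Sum>i<n. norm (c i)) * norm z ^ k"
      using Suc by simp
    moreover have "0 < norm z ^ k"
      using False by (intro zero_less_power) linarith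
    ultimately have "norm z \<le> (\<Sum>i<n. norm (c i))"
      by (metis mult_le_cancel_right_pos)
    then show ?thesis by simp
  qed
qed

lemma norm_le_sum_vieta:
  assumes "j < n"
  shows "norm (x j) \<le> 1 + (\<Sum>i<n. norm (vieta n x i))"
proof (rule norm_root_le)
  have "poly (root_poly n x) (x j) = 0"
    using assms by (auto simp: root_poly_def poly_prod)
  then have "(\<Sum>i\<le>n. coeff (root_poly n x) i * x j ^ i) = 0"
    by (simp add: poly_altdef degree_root_poly)
  moreover have "{..n} = insert n {..<n}" by auto
  ultimately have "x j ^ n + (\<Sum>i<n. coeff (root_poly n x) i * x j ^ i) = 0"
    by (simp add: coeff_root_poly_degree)
  then show "x j ^ n = - (\<Sum>i<n. vieta n x i * x j ^ i)"
    by (simp add: vieta_def eq_neg_iff_add_eq_0)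
qed

text \<open>
  The root bound makes the preimage of a compact set bounded, so the map from roots to coefficients
  is proper, hence closed. It is surjective by the fundamental theorem of algebra.
\<close>

lemma quotient_map_vieta:
  "quotient_map (power_topology euclidean n) (power_topology euclidean n) (vieta n)"
proof (rule continuous_closed_imp_quotient_map[OF continuous_map_vieta])
  let ?P = "power_topology (euclidean :: complex topology) n"
  show "vieta n ` topspace ?P = topspace ?P"
  proof
    show "topspace ?P \<subseteq> vieta n ` topspace ?P"
    proof
      fix c assume "c \<in> topspace ?P"
      then obtain x where "x \<in> extensional {..<n}" "vieta n x = c"
        using vieta_surj[of c n] by (auto simp: PiE_def)
      then show "c \<in> vieta n ` topspace ?P"
        by (auto simp: PiE_def)
    qed
  qed (auto simp: vieta_def)
  have "proper_map ?P ?P (vieta n)"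
  proof (rule compact_imp_proper_map)
    show "k_space ?P"
      by (intro locally_compact_imp_k_space disjI1)
         (auto simp: locally_compact_space_product_topology locally_compact_space_euclidean)
    show "kc_space ?P"
      by (intro Hausdorff_imp_kc_space) (simp add: Hausdorff_space_product_topology)
    show "vieta n \<in> topspace ?P \<rightarrow> topspace ?P"
      by (auto simp: vieta_def)
    show "continuous_map ?P ?P (vieta n) \<or> kc_space ?P"
      using continuous_map_vieta by blast
    fix K assume K: "compactin ?P K"
    then have "closedin ?P K"
      by (intro compactin_imp_closedin) (auto simp: Hausdorff_space_product_topology)
    then have closed: "closedin ?P {x \<in> topspace ?P. vieta n x \<in> K}"
      by (rule closedin_continuous_map_preimage[OF continuous_map_vieta])
    have "\<exists>B. \<forall>c\<in>K. norm (c i) \<le> B" if "i < n" for i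
    proof -
      have "compactin euclidean ((\<lambda>c. c i) ` K)"
        using K that by (intro image_compactin[OF _ continuous_map_product_projection]) auto
      then show ?thesis
        by (auto dest!: compact_imp_bounded simp: bounded_iff)
    qed
    then obtain B where B: "\<And>i c. i < n \<Longrightarrow> c \<in> K \<Longrightarrow> norm (c i) \<le> B i"
      by metis
    define R where "R = 1 + (\<Sum>i<n. B i)"
    have "norm (x j) \<le> R" if "vieta n x \<in> K" "j < n" for x j
      unfolding R_def using norm_le_sum_vieta[OF that(2), of x] B[OF _ that(1)]
      by (smt (verit) lessThan_iff sum_mono)
    then have "{x \<in> topspace ?P. vieta n x \<in> K} \<subseteq> PiE {..<n} (\<lambda>_. cball 0 R)"
      by (auto simp: PiE_def)
    moreover have "compactin ?P (PiE {..<n} (\<lambda>_. cball 0 R))"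
      by (simp add: compactin_PiE)
    ultimately show "compactin ?P {x \<in> topspace ?P. vieta n x \<in> K}"
      using closed closed_compactin by blast
  qed
  then show "closed_map ?P ?P (vieta n)"
    by (rule proper_imp_closed_map)
qed

lemma sym_product_complex_homeomorphic_space_Euclidean_space:
  "sym_product (euclidean :: complex topology) n homeomorphic_space Euclidean_space (2 * n)"
  using quotient_maps_same_fibres_imp_homeomorphic_space[OF quotient_map_tuple_mset quotient_map_vieta]
    power_topology_complex_homeomorphic_space_Euclidean_space vieta_eq_iff homeomorphic_space_trans
  by metis

section \<open>The two sides of a Jordan curve in the projective line\<close>

lemma openin_CP1_insert_None: "compact K \<Longrightarrow> openin CP1 (insert None (Some ` (- K)))"
  unfolding CP1_def openin_Alexandroff_compactification
  by (metis (no_types, lifting) Compl_eq_Diff_UNIV closed_closedin compact_imp_closed compactin_euclidean_iff topspace_euclidean)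

lemma openin_CP1_cases:
  assumes "openin CP1 V"
  obtains (finite) W where "open W" "V = Some ` W"
    | (infinite) K where "compact K" "V = insert None (Some ` (- K))"
  using assms unfolding CP1_def openin_Alexandroff_compactification
  by (auto simp: Compl_eq_Diff_UNIV)

lemma continuous_map_CP1_I:
  assumes "\<And>W. open W \<Longrightarrow> openin CP1 (f -` (Some ` W))"
    and "\<And>K. compact K \<Longrightarrow> openin CP1 (f -` (insert None (Some ` (- K))))"
  shows "continuous_map CP1 CP1 f"
proof -
  have "openin CP1 {x \<in> topspace CP1. f x \<in> V}" if "openin CP1 V" for V
    using that assms by (cases rule: openin_CP1_cases) (auto simp: vimage_def)
  then show ?thesis by (auto simp: continuous_map_def)
qed

lemma mem_translation_iff: "z \<in> (+) a ` S \<longleftrightarrow> z - a \<in> S" for z a :: complex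
  by (auto simp: image_iff intro: bexI[of _ "z - a"])

lemma continuous_map_CP1_translation: "continuous_map CP1 CP1 (map_option (\<lambda>z. z - a))"
proof (rule continuous_map_CP1_I)
  fix W :: "complex set" assume "open W"
  then have "open ((+) a ` W)" by (rule open_translation)
  moreover have "x \<in> map_option (\<lambda>z. z - a) -` (Some ` W) \<longleftrightarrow> x \<in> Some ` ((+) a ` W)" for x
    by (cases x) (auto simp: mem_translation_iff inj_image_mem_iff)
  then have "map_option (\<lambda>z. z - a) -` (Some ` W) = Some ` ((+) a ` W)"
    by blast
  ultimately show "openin CP1 (map_option (\<lambda>z. z - a) -` (Some ` W))" by simp
next
  fix K :: "complex set" assume "compact K"
  then have "compact ((+) a ` K)" by (rule compact_translation)
  moreover have "x \<in> map_option (\<lambda>z. z - a) -` (insert None (Some ` (- K))) \<longleftrightarrow>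
      x \<in> insert None (Some ` (- (+) a ` K))" for x
    by (cases x) (auto simp: mem_translation_iff)
  then have "map_option (\<lambda>z. z - a) -` (insert None (Some ` (- K))) = insert None (Some ` (- (+) a ` K))"
    by blast
  ultimately show "openin CP1 (map_option (\<lambda>z. z - a) -` (insert None (Some ` (- K))))"
    by (simp add: openin_CP1_insert_None)
qed

definition inversion :: "complex option \<Rightarrow> complex option" where
  "inversion x = (case x of None \<Rightarrow> Some 0 | Some z \<Rightarrow> if z = 0 then None else Some (inverse z))"

lemma inversion_inversion [simp]: "inversion (inversion x) = x"
  by (auto simp: inversion_def split: option.splits)

lemma open_inverse_preimage:
  fixes W :: "complex set"
  assumes "open W"
  shows "open {z. z \<noteq> 0 \<and> inverse z \<in> W}"
proof -
  have "open ((- {0}) \<inter> inverse -` W)"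
    using assms by (intro continuous_open_preimage) (auto intro!: continuous_intros)
  then show ?thesis by (simp add: vimage_def Int_def)
qed

lemma continuous_map_inversion: "continuous_map CP1 CP1 inversion"
proof (rule continuous_map_CP1_I)
  fix W :: "complex set" assume W: "open W"
  show "openin CP1 (inversion -` (Some ` W))"
  proof (cases "0 \<in> W")
    case False
    then have "x \<in> inversion -` (Some ` W) \<longleftrightarrow> x \<in> Some ` {z. z \<noteq> 0 \<and> inverse z \<in> W}" for x
      by (cases x) (auto simp: inversion_def)
    then have "inversion -` (Some ` W) = Some ` {z. z \<noteq> 0 \<and> inverse z \<in> W}" by blast
    then show ?thesis using open_inverse_preimage[OF W] by simp
  next
    case True
    let ?K = "- {z. z \<noteq> 0 \<and> inverse z \<in> W}"
    from W True obtain e where e: "e > 0" "ball 0 e \<subseteq> W"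
      by (meson openE)
    have "norm z \<le> inverse e" if "z \<in> ?K" for z
    proof (rule ccontr)
      assume "\<not> norm z \<le> inverse e"
      then have "norm z > inverse e" "z \<noteq> 0" using e(1) by auto
      then have "norm (inverse z) < e"
        using e(1) by (metis inverse_inverse_eq inverse_positive_iff_positive less_imp_inverse_less norm_inverse)
      then show False using that e(2) \<open>z \<noteq> 0\<close> by auto
    qed
    then have "bounded ?K" by (auto simp: bounded_iff)
    then have "compact ?K"
      using open_inverse_preimage[OF W] by (simp add: compact_eq_bounded_closed closed_Compl)
    moreover have "x \<in> inversion -` (Some ` W) \<longleftrightarrow> x \<in> insert None (Some ` (- ?K))" for x
      using True by (cases x) (auto simp: inversion_def)
    then have "inversion -` (Some ` W) = insert None (Some ` (- ?K))" by blast
    ultimately show ?thesis using openin_CP1_insert_None by metis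
  qed
next
  fix K :: "complex set" assume K: "compact K"
  then have *: "open {z. z \<noteq> 0 \<and> inverse z \<in> - K}"
    by (intro open_inverse_preimage) (simp add: compact_imp_closed open_Compl)
  show "openin CP1 (inversion -` (insert None (Some ` (- K))))"
  proof (cases "0 \<in> K")
    case True
    from K obtain B where B: "B > 0" "\<And>z. z \<in> K \<Longrightarrow> norm z \<le> B"
      using compact_imp_bounded bounded_pos by metis
    have "inverse z \<notin> K" if "z \<noteq> 0" "norm z < inverse B" for z
    proof
      assume "inverse z \<in> K"
      then have "inverse (norm z) \<le> B" using B(2) by (metis norm_inverse)
      moreover have "B < inverse (norm z)"
        using that B(1) by (metis inverse_inverse_eq less_imp_inverse_less zero_less_norm_iff)
      ultimately show False by simp
    qed
    then have "insert 0 {z. z \<noteq> 0 \<and> inverse z \<in> - K} = {z. z \<noteq> 0 \<and> inverse z \<in> - K} \<union> ball 0 (inverse B)"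
      using B(1) by auto
    then have "open (insert 0 {z. z \<noteq> 0 \<and> inverse z \<in> - K})"
      using * by (simp add: open_Un)
    moreover have "x \<in> inversion -` (insert None (Some ` (- K))) \<longleftrightarrow>
        x \<in> Some ` (insert 0 {z. z \<noteq> 0 \<and> inverse z \<in> - K})" for x
      using True by (cases x) (auto simp: inversion_def)
    then have "inversion -` (insert None (Some ` (- K))) = Some ` (insert 0 {z. z \<noteq> 0 \<and> inverse z \<in> - K})"
      by blast
    ultimately show ?thesis by (metis openin_CP1_image_Some)
  next
    case False
    then have "compact (inverse ` K)"
      by (intro compact_continuous_image K continuous_intros) auto
    moreover have "x \<in> inversion -` (insert None (Some ` (- K))) \<longleftrightarrow>
        x \<in> insert None (Some ` (- (inverse ` K)))" for x
      using False by (cases x) (auto simp: inversion_def image_iff intro: bexI[of _ "inverse _"])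
    then have "inversion -` (insert None (Some ` (- K))) = insert None (Some ` (- (inverse ` K)))"
      by blast
    ultimately show ?thesis using openin_CP1_insert_None by metis
  qed
qed

lemma ex_homeomorphic_map_CP1_to_infinity:
  obtains \<phi> where "homeomorphic_map CP1 CP1 \<phi>" "\<phi> p = None"
proof (cases p)
  case None
  then show ?thesis using that[of id] by simp
next
  case (Some a)
  have "homeomorphic_maps CP1 CP1 (map_option (\<lambda>z. z - a)) (map_option (\<lambda>z. z - (- a)))"
    unfolding homeomorphic_maps_def
    using continuous_map_CP1_translation[of a] continuous_map_CP1_translation[of "- a"]
    by (auto simp: option.map_comp o_def option.map_ident)
  moreover have "homeomorphic_maps CP1 CP1 inversion inversion"
    unfolding homeomorphic_maps_def using continuous_map_inversion by auto
  ultimately have "homeomorphic_map CP1 CP1 (inversion \<circ> map_option (\<lambda>z. z - a))"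
    by (meson homeomorphic_map_compose homeomorphic_map_maps)
  then show ?thesis
    using that[of "inversion \<circ> map_option (\<lambda>z. z - a)"] Some by (simp add: inversion_def)
qed

lemma homeomorphic_imp_homeomorphic_space:
  "S homeomorphic T \<Longrightarrow> top_of_set S homeomorphic_space top_of_set T"
proof -
  assume "S homeomorphic T"
  then obtain f g where "homeomorphism S T f g"
    unfolding homeomorphic_def by blast
  then have "homeomorphic_maps (top_of_set S) (top_of_set T) f g"
    unfolding homeomorphism_def homeomorphic_maps_def by (auto simp: continuous_map_in_subtopology)
  then show ?thesis
    unfolding homeomorphic_space_def by blast
qed

lemma Some_image_homeomorphic_space: "subtopology CP1 (Some ` S) homeomorphic_space top_of_set S"
proof -
  have "embedding_map euclidean CP1 Some"
    unfolding CP1_def by (rule embedding_map_Some)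
  then have "homeomorphic_map euclidean (subtopology CP1 (range Some)) Some"
    by (simp add: embedding_map_def)
  then have "homeomorphic_map (top_of_set S) (subtopology (subtopology CP1 (range Some)) (Some ` S)) Some"
    by (intro homeomorphic_map_subtopologies) auto
  moreover have "subtopology (subtopology CP1 (range Some)) (Some ` S) = subtopology CP1 (Some ` S)"
    by (simp add: subtopology_subtopology image_mono inf.absorb2)
  ultimately show ?thesis
    using homeomorphic_map_imp_homeomorphic_space homeomorphic_space_sym by metis
qed

lemma simple_closed_curve_if_homeomorphic_circle:
  fixes J :: "complex set"
  assumes "subtopology CP1 (Some ` J) homeomorphic_space circle"
  obtains c where "simple_path c" "pathfinish c = pathstart c" "path_image c = J"
proof -
  have "circle homeomorphic_space top_of_set J"
    using assms Some_image_homeomorphic_space homeomorphic_space_sym homeomorphic_space_trans by blast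
  then obtain f where f: "homeomorphic_map circle (top_of_set J) f"
    using homeomorphic_space by blast
  then have "continuous_on (sphere 0 1) f" "inj_on f (sphere 0 1)" "f ` sphere 0 1 = J"
    using homeomorphic_imp_continuous_map[OF f] homeomorphic_imp_injective_map[OF f]
      homeomorphic_imp_surjective_map[OF f]
    by (auto simp: continuous_map_in_subtopology)
  moreover have "path_image (circlepath 0 1) = sphere 0 1"
    by simp
  ultimately have "simple_path (f \<circ> circlepath 0 1)" "path_image (f \<circ> circlepath 0 1) = J"
    by (auto intro!: simple_path_continuous_image simp: path_image_compose simple_path_circlepath)
  moreover have "pathfinish (f \<circ> circlepath 0 1) = pathstart (f \<circ> circlepath 0 1)"
    by (simp add: pathfinish_compose pathstart_compose)
  ultimately show thesis using that by blast
qed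

text \<open>
  If the domain contains infinity, its boundary is a Jordan curve \<open>J\<close> in the plane. The outside of
  \<open>J\<close> is connected and reaches infinity, so it lies in the domain; the inside cannot lie in it as
  well, because then the domain would be the disjoint union of two open sets, the inside and the outside
  together with infinity. So the remaining side is the inside of \<open>J\<close>.
\<close>

lemma complement_of_domain_at_infinity:
  assumes U: "openin CP1 U" "connectedin CP1 U" "None \<in> U"
    and C: "subtopology CP1 (CP1 closure_of U - U) homeomorphic_space circle"
  shows "\<exists>V. - (CP1 closure_of U) = Some ` V \<and> V \<noteq> {} \<and> open V \<and> connected V \<and> simply_connected V \<and>
    bounded V \<and> Some ` frontier V = CP1 closure_of U - U"
proof -
  define J where "J = Some -` (CP1 closure_of U - U)"
  define U' where "U' = Some -` U"
  define V where "V = - U' - J"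
  have SJ: "Some ` J = CP1 closure_of U - U"
  proof -
    have "x \<in> Some ` J \<longleftrightarrow> x \<in> CP1 closure_of U - U" for x
      using U(3) by (cases x) (auto simp: J_def)
    then show ?thesis by blast
  qed
  have cl: "U \<subseteq> CP1 closure_of U"
    by (simp add: closure_of_subset)
  have SV: "- (CP1 closure_of U) = Some ` V"
  proof -
    have "x \<in> Some ` V \<longleftrightarrow> x \<in> - (CP1 closure_of U)" for x
      using U(3) cl by (cases x) (auto simp: V_def J_def U'_def)
    then show ?thesis by blast
  qed
  have "openin CP1 (topspace CP1 - CP1 closure_of U)"
    by (metis closedin_closure_of closedin_def)
  then have "open V"
    using SV by (simp add: Compl_eq_Diff_UNIV)
  have "U = insert None (Some ` U')"
  proof -
    have "x \<in> U \<longleftrightarrow> x \<in> insert None (Some ` U')" for x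
      using U(3) by (cases x) (auto simp: U'_def)
    then show ?thesis by blast
  qed
  with U(1) obtain K where K: "compact K" "U' = - K"
    by (cases rule: openin_CP1_cases) (auto simp: inj_image_eq_iff insert_eq_iff)
  then have "open U'"
    by (simp add: compact_imp_closed open_Compl)
  obtain c where c: "simple_path c" "pathfinish c = pathstart c" "path_image c = J"
    using simple_closed_curve_if_homeomorphic_circle C SJ by metis
  define I where "I = inside J"
  define O' where "O' = outside J"
  have I: "I \<noteq> {}" "open I" "connected I" "bounded I" "frontier I = J" "simply_connected I"
    and O': "O' \<noteq> {}" "open O'" "connected O'" "\<not> bounded O'"
    and IO: "I \<inter> O' = {}" "I \<union> O' = - J"
    using Jordan_inside_outside[OF c(1,2)] simply_connected_inside_simple_path[OF c(1)]
    unfolding c(3) I_def O'_def by blast+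
  have disj: "U' \<inter> V = {}" "U' \<union> V = - J"
    by (auto simp: V_def U'_def J_def)
  \<comment> \<open>The domain is open and closed in the complement of the curve.\<close>
  have clopen: "S \<subseteq> U' \<or> S \<inter> U' = {}" if "connected S" "S \<subseteq> - J" for S
    using connectedD[OF that(1) \<open>open U'\<close> \<open>open V\<close>] that(2) disj by blast
  have "O' \<inter> U' \<noteq> {}"
  proof
    assume "O' \<inter> U' = {}"
    then have "O' \<subseteq> K" using K(2) by auto
    then show False
      using K(1) O'(4) bounded_subset compact_imp_bounded by blast
  qed
  then have out: "O' \<subseteq> U'"
    using clopen[OF O'(3)] IO(2) by blast
  have "\<not> I \<subseteq> U'"
  proof
    assume "I \<subseteq> U'"
    then have "U' = I \<union> O'"
      using out disj IO by blast
    then have U_eq: "U = Some ` I \<union> insert None (Some ` O')"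
      using \<open>U = insert None (Some ` U')\<close> by (simp add: image_Un)
    have "- O' = J \<union> I"
      using IO by blast
    moreover have "bounded J"
      using bounded_simple_path_image[OF c(1)] c(3) by simp
    ultimately have "compact (- O')"
      using O'(2) I(4) by (metis bounded_Un closed_Compl compact_eq_bounded_closed)
    from openin_CP1_insert_None[OF this] have "openin CP1 (insert None (Some ` O'))"
      by simp
    moreover have "openin CP1 (Some ` I)" using I(2) by simp
    moreover have "Some ` I \<inter> insert None (Some ` O') = {}"
      using IO(1) by auto
    ultimately show False
      using connectedinD[OF U(2), of "Some ` I" "insert None (Some ` O')"] I(1) U_eq by auto
  qed
  then have "I \<inter> U' = {}"
    using clopen[OF I(3)] IO(2) by blast
  then have "V = I"
    using disj out IO by blast
  then show ?thesis
    using SV SJ I by (intro exI[of _ I]) simp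
qed

text \<open>
  The complement of the closure is again a connected open set with the same boundary, so the
  lemma can be applied a second time, to that complement, and then describes the domain itself.
\<close>

lemma complement_of_domain:
  assumes U: "openin CP1 U" "connectedin CP1 U"
    and C: "subtopology CP1 (CP1 closure_of U - U) homeomorphic_space circle"
  shows "openin CP1 (- (CP1 closure_of U))" "connectedin CP1 (- (CP1 closure_of U))"
    "CP1 closure_of (- (CP1 closure_of U)) = - U"
    "subtopology CP1 (- (CP1 closure_of U)) homeomorphic_space (euclidean :: complex topology)"
proof -
  let ?V = "- (CP1 closure_of U)"
  have "U \<noteq> {}"
  proof
    assume "U = {}"
    then have "(trivial_topology :: complex option topology) homeomorphic_space circle" using C by simp
    then show False
      using homeomorphic_empty_space by (metis homeomorphic_space_sym sphere_eq_empty null_topspace_iff_trivial topspace_euclidean_subtopology not_one_less_zero)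
  qed
  then obtain p where p: "p \<in> U" by blast
  obtain \<phi> where \<phi>: "homeomorphic_map CP1 CP1 \<phi>" "\<phi> p = None"
    by (rule ex_homeomorphic_map_CP1_to_infinity)
  have bij: "bij \<phi>"
    using \<phi>(1) homeomorphic_imp_surjective_map homeomorphic_imp_injective_map
    by (fastforce simp: bij_def)
  have cl: "CP1 closure_of (\<phi> ` S) = \<phi> ` (CP1 closure_of S)" for S
    using homeomorphic_map_closure_of[OF \<phi>(1)] by simp
  have sub: "subtopology CP1 (\<phi> ` S) homeomorphic_space subtopology CP1 S" for S
    using homeomorphic_map_subtopologies[OF \<phi>(1), of S "\<phi> ` S"]
    by (metis homeomorphic_map_imp_homeomorphic_space homeomorphic_space_sym inf_top_left topspace_CP1)
  have compl: "\<phi> ` (- S) = - \<phi> ` S" "\<phi> ` (S - T) = \<phi> ` S - \<phi> ` T" for S T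
    using bij by (simp_all add: bij_image_Compl_eq image_set_diff bij_is_inj)
  have "openin CP1 (\<phi> ` U)" "connectedin CP1 (\<phi> ` U)"
    using U homeomorphic_map_openness[OF \<phi>(1), of U] homeomorphic_map_connectedness[OF \<phi>(1), of U] by simp_all
  moreover have "None \<in> \<phi> ` U" using p \<phi>(2) by force
  moreover have "subtopology CP1 (CP1 closure_of (\<phi> ` U) - \<phi> ` U) homeomorphic_space circle"
    using sub[of "CP1 closure_of U - U"] C unfolding cl compl(2)[symmetric] by (rule homeomorphic_space_trans)
  ultimately obtain V where V: "\<phi> ` ?V = Some ` V" "V \<noteq> {}" "open V" "connected V" "simply_connected V" "bounded V"
      "Some ` frontier V = \<phi> ` (CP1 closure_of U - U)"
    using complement_of_domain_at_infinity[of "\<phi> ` U"] unfolding cl compl by auto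
  show "openin CP1 ?V"
    using V homeomorphic_map_openness[OF \<phi>(1), of ?V] by simp
  show "connectedin CP1 ?V"
    using V homeomorphic_map_connectedness[OF \<phi>(1), of ?V] by (simp add: connectedin_CP1_image_Some)
  have "V homeomorphic ball (0::complex) 1"
    using V simply_connected_eq_homeomorphic_to_disc by blast
  then have "V homeomorphic (UNIV :: complex set)"
    using homeomorphic_ball01_UNIV homeomorphic_trans by blast
  then have "subtopology CP1 (\<phi> ` ?V) homeomorphic_space (euclidean :: complex topology)"
    unfolding V(1) using Some_image_homeomorphic_space[of V] homeomorphic_imp_homeomorphic_space
    by (metis homeomorphic_space_trans subtopology_UNIV)
  then show "subtopology CP1 ?V homeomorphic_space (euclidean :: complex topology)"
    using sub homeomorphic_space_sym homeomorphic_space_trans by blast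
  have "closedin CP1 (Some ` closure V)"
    using V by (simp add: CP1_def)
  then have "CP1 closure_of (Some ` V) = Some ` closure V"
    by (intro subset_antisym closure_of_minimal image_mono closure_subset image_Some_closure_subset)
  also have "closure V = V \<union> frontier V"
    by (rule closure_Un_frontier)
  finally have "\<phi> ` (CP1 closure_of ?V) = \<phi> ` (?V \<union> (CP1 closure_of U - U))"
    using V by (metis cl image_Un)
  then have "CP1 closure_of ?V = ?V \<union> (CP1 closure_of U - U)"
    using bij by (simp add: inj_image_eq_iff bij_is_inj)
  then show "CP1 closure_of ?V = - U"
    using closure_of_subset[of U CP1] by auto
qed

lemma stable_unstable_homeomorphic_space_complex:
  assumes U: "openin CP1 U" "connectedin CP1 U"
    and C: "subtopology CP1 (semistable U) homeomorphic_space circle"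
  shows "subtopology CP1 (stable U) homeomorphic_space (euclidean :: complex topology)"
    "subtopology CP1 (unstable U) homeomorphic_space (euclidean :: complex topology)"
    "openin CP1 (unstable U)"
proof -
  let ?V = "- (CP1 closure_of U)"
  have un: "unstable U = ?V"
    by (simp add: unstable_def Compl_eq_Diff_UNIV)
  have C': "subtopology CP1 (CP1 closure_of U - U) homeomorphic_space circle"
    using C by (simp add: semistable_def)
  note V = complement_of_domain[OF U C']
  show "subtopology CP1 (unstable U) homeomorphic_space (euclidean :: complex topology)"
    "openin CP1 (unstable U)"
    using V un by simp_all
  have "CP1 closure_of ?V - ?V = CP1 closure_of U - U"
    unfolding V(3) by auto
  then have "subtopology CP1 (- (CP1 closure_of ?V)) homeomorphic_space (euclidean :: complex topology)"
    using complement_of_domain(4)[OF V(1,2)] C' by simp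
  then show "subtopology CP1 (stable U) homeomorphic_space (euclidean :: complex topology)"
    unfolding V(3) by (simp add: stable_def)
qed

section \<open>Lifts of point configurations on the circle\<close>

text \<open>
  Such a sequence enumerates, in increasing order and with multiplicities, all reals lying above \<open>l\<close>
  points of a circle of length \<open>1\<close>. The points determine it up to a shift of the index.
\<close>

definition staircase :: "nat \<Rightarrow> (int \<Rightarrow> real) \<Rightarrow> bool" where
  "staircase l u \<longleftrightarrow> mono u \<and> (\<forall>i. u (i + int l) = u i + 1)"

definition circle_mset :: "nat \<Rightarrow> (int \<Rightarrow> real) \<Rightarrow> complex multiset" where
  "circle_mset l u = tuple_mset l (\<lambda>i. cis (2 * pi * u (int i)))"

text \<open>
  The quasiperiodic sequence with prescribed values at the indices \<open>0, \<dots>, l - 1\<close>.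
\<close>

definition extend :: "nat \<Rightarrow> (nat \<Rightarrow> real) \<Rightarrow> int \<Rightarrow> real" where
  "extend l t i = t (nat (i mod int l)) + of_int (i div int l)"

lemma extend_nat [simp]: "i < l \<Longrightarrow> extend l t (int i) = t i"
  by (simp add: extend_def)

lemma extend_add: "l > 0 \<Longrightarrow> extend l t (i + int l) = extend l t i + 1"
  by (simp add: extend_def)

lemma periodic_sum_shift:
  fixes F :: "int \<Rightarrow> 'a::ab_group_add"
  shows "(\<Sum>i<l. F (int i + 1)) = (\<Sum>i<l. F (int i)) + F (int l) - F 0"
  by (induction l) (auto simp: algebra_simps)

lemma quasiperiodic_int:
  assumes "\<And>i. u (i + int l) = u i + (c :: real)"
  shows "u (i + int l * k) = u i + of_int k * c"
proof (induction k rule: int_induct[where k = 0])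
  case (step1 k)
  have "u (i + int l * (k + 1)) = u ((i + int l * k) + int l)" by (simp add: algebra_simps)
  also have "\<dots> = u i + of_int (k + 1) * c" unfolding assms step1(2) by (simp add: algebra_simps)
  finally show ?case .
next
  case (step2 k)
  have "u (i + int l * k) = u ((i + int l * (k - 1)) + int l)" by (simp add: algebra_simps)
  then show ?case unfolding assms step2(2) by (simp add: algebra_simps)
qed simp

lemma staircase_add_mult: "staircase l u \<Longrightarrow> u (i + int l * k) = u i + of_int k"
  using quasiperiodic_int[of u l 1 i k] by (simp add: staircase_def)

lemma extend_restrict:
  assumes "staircase l u" "l > 0" "\<And>i. i < l \<Longrightarrow> t i = u (int i)"
  shows "extend l t = u"
proof
  fix i
  have "u (i mod int l + int l * (i div int l)) = u (i mod int l) + of_int (i div int l)"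
    by (rule staircase_add_mult[OF assms(1)])
  moreover have "t (nat (i mod int l)) = u (i mod int l)"
    using assms(2) assms(3)[of "nat (i mod int l)"] by (simp add: nat_less_iff)
  ultimately show "extend l t i = u i"
    by (simp add: extend_def)
qed

lemma staircase_extend:
  assumes l: "l > 0" and t: "\<And>i. i < l \<Longrightarrow> extend l t (int i) \<le> extend l t (int i + 1)"
  shows "staircase l (extend l t)"
proof -
  have incr: "extend l t i \<le> extend l t (i + 1)" for i
  proof -
    have q: "extend l t (j + int l * k) = extend l t j + of_int k" for j k
      using quasiperiodic_int[of "extend l t" l 1 j k] extend_add[OF l] by simp
    have i: "i = i mod int l + int l * (i div int l)" by simp
    have "extend l t (int (nat (i mod int l))) \<le> extend l t (int (nat (i mod int l)) + 1)"
      using l by (intro t) (simp add: nat_less_iff)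
    then have "extend l t (i mod int l) \<le> extend l t (i mod int l + 1)"
      using l by simp
    then have "extend l t (i mod int l + int l * (i div int l)) \<le> extend l t ((i mod int l + 1) + int l * (i div int l))"
      unfolding q by simp
    moreover have "(i mod int l + 1) + int l * (i div int l) = i + 1"
      using i by linarith
    ultimately show ?thesis using i by simp
  qed
  have "extend l t i \<le> extend l t j" if "i \<le> j" for i j
    using that
  proof (induction j rule: int_ge_induct)
    case (step j)
    then show ?case using incr[of j] by linarith
  qed simp
  then show ?thesis
    unfolding staircase_def using extend_add[OF l] by (auto intro: monoI)
qed

lemma staircase_shift: "staircase l u \<Longrightarrow> staircase l (\<lambda>i. u (i + d))"
proof -
  assume u: "staircase l u"
  have "u (i + int l + d) = u (i + d) + 1" for i
  proof -
    have "i + int l + d = (i + d) + int l" by simp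
    then show ?thesis using u unfolding staircase_def by metis
  qed
  then show ?thesis
    using u by (auto simp: staircase_def mono_def)
qed

lemma circle_mset_shift:
  assumes "staircase l u"
  shows "circle_mset l (\<lambda>i. u (i + d)) = circle_mset l u"
proof -
  have one: "circle_mset l (\<lambda>i. v (i + 1)) = circle_mset l v" if v: "staircase l v" for v
  proof (cases l)
    case 0
    then show ?thesis by (simp add: circle_mset_def)
  next
    case (Suc n)
    have "v (int n + 1) = v 0 + 1"
      using v Suc unfolding staircase_def by (metis add.commute add_0 of_nat_Suc)
    then have last: "cis (2 * pi * v (int n + 1)) = cis (2 * pi * v 0)"
      by (simp add: distrib_left cis_mult[symmetric])
    have "circle_mset l v = tuple_mset (1 + n) (\<lambda>i. cis (2 * pi * v (int i)))"
      by (simp add: circle_mset_def Suc)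
    also have "\<dots> = {#cis (2 * pi * v 0)#} + tuple_mset n (\<lambda>i. cis (2 * pi * v (int i + 1)))"
      unfolding tuple_mset_add by (simp add: lessThan_Suc add.commute)
    also have "\<dots> = tuple_mset (n + 1) (\<lambda>i. cis (2 * pi * v (int i + 1)))"
      unfolding tuple_mset_add using last by (simp add: lessThan_Suc)
    finally show ?thesis
      by (simp add: circle_mset_def Suc)
  qed
  show ?thesis
  proof (induction d rule: int_induct[where k = 0])
    case (step1 d)
    then show ?case
      using one[OF staircase_shift[OF assms, of d]] by (simp add: algebra_simps)
  next
    case (step2 d)
    then show ?case
      using one[OF staircase_shift[OF assms, of "d - 1"]] by (simp add: algebra_simps)
  qed simp
qed

lemma sum_shift:
  assumes "staircase l u"
  shows "(\<Sum>i<l. u (int i + d)) = (\<Sum>i<l. u (int i)) + of_int d"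
proof -
  have one: "(\<Sum>i<l. v (int i + 1)) = (\<Sum>i<l. v (int i)) + 1" if v: "staircase l v" for v
  proof -
    have "v (int l) = v 0 + 1" using v unfolding staircase_def by (metis add_0)
    then show ?thesis by (simp add: periodic_sum_shift)
  qed
  show ?thesis
  proof (induction d rule: int_induct[where k = 0])
    case (step1 d)
    then show ?case
      using one[OF staircase_shift[OF assms, of d]] by (simp add: algebra_simps)
  next
    case (step2 d)
    then show ?case
      using one[OF staircase_shift[OF assms, of "d - 1"]] by (simp add: algebra_simps)
  qed simp
qed

text \<open>
  A staircase is unbounded in both directions, so it changes sign. Starting the
  indexing at the sign change puts the first \<open>l\<close> values into \<open>[0, 1)\<close>.
\<close>

lemma staircase_first_nonneg:
  assumes u: "staircase l u"
  obtains d where "0 \<le> u d" "u (d - 1) < 0"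
proof -
  define N where "N = \<lceil>\<bar>u 0\<bar>\<rceil> + 1"
  have N: "real_of_int N > \<bar>u 0\<bar>"
    unfolding N_def by linarith
  have lo: "u (int l * - N) < 0" and hi: "u (int l * N) \<ge> 0"
    using staircase_add_mult[OF u, of 0 "- N"] staircase_add_mult[OF u, of 0 N] N by auto
  define P where "P n \<longleftrightarrow> 0 \<le> u (int l * - N + int n)" for n
  have "N \<ge> 0" using N by linarith
  then have "int l * - N + int (nat (int l * N + int l * N)) = int l * N" by simp
  then have "P (nat (int l * N + int l * N))"
    using hi unfolding P_def by metis
  then have least: "P (LEAST n. P n)" by (rule LeastI)
  moreover have "\<not> P 0" using lo by (simp add: P_def)
  ultimately obtain m where m: "(LEAST n. P n) = Suc m"
    using not0_implies_Suc by metis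
  then have "\<not> P m" by (metis not_less_Least lessI)
  then show thesis
    using least m that[of "int l * - N + int (Suc m)"] by (simp add: P_def)
qed

lemma Arg2pi_cis: "0 \<le> x \<Longrightarrow> x < 2 * pi \<Longrightarrow> Arg2pi (cis x) = x"
  using Arg2pi_unique[of 1 x "cis x"] by (simp add: cis_conv_exp)

text \<open>
  Once the first \<open>l\<close> values lie in \<open>[0, 1)\<close>, they are the sorted list of the angles of the points.
\<close>

lemma staircase_standard_unique:
  assumes l: "l > 0" and u: "staircase l u" "0 \<le> u 0" "u (int l - 1) < 1"
    and v: "staircase l v" "0 \<le> v 0" "v (int l - 1) < 1"
    and eq: "circle_mset l u = circle_mset l v"
  shows "u = v"
proof -
  have *: "mset (map (\<lambda>i. w (int i)) [0..<l]) = image_mset (\<lambda>z. Arg2pi z / (2 * pi)) (circle_mset l w) \<and>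
      sorted (map (\<lambda>i. w (int i)) [0..<l])"
    if w: "staircase l w" "0 \<le> w 0" "w (int l - 1) < 1" for w
  proof
    have mono: "mono w" using w(1) by (simp add: staircase_def)
    then show "sorted (map (\<lambda>i. w (int i)) [0..<l])"
      by (auto simp: sorted_iff_nth_mono monoD)
    have "0 \<le> w (int i)" "w (int i) < 1" if "i < l" for i
      using w(2,3) monoD[OF mono, of 0 "int i"] monoD[OF mono, of "int i" "int l - 1"] that by auto
    then have "tuple_mset l (\<lambda>i. Arg2pi (cis (2 * pi * w (int i))) / (2 * pi)) = tuple_mset l (\<lambda>i. w (int i))"
      by (intro tuple_mset_cong) (simp add: Arg2pi_cis)
    then show "mset (map (\<lambda>i. w (int i)) [0..<l]) = image_mset (\<lambda>z. Arg2pi z / (2 * pi)) (circle_mset l w)"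
      by (simp add: circle_mset_def multiset.map_comp o_def atLeast0LessThan)
  qed
  have "map (\<lambda>i. u (int i)) [0..<l] = map (\<lambda>i. v (int i)) [0..<l]"
    using *[OF u] *[OF v] eq by (metis properties_for_sort)
  then have "u (int i) = v (int i)" if "i < l" for i
    using that arg_cong[of _ _ "\<lambda>xs. xs ! i"] by fastforce
  then have "extend l (\<lambda>i. u (int i)) = v"
    by (rule extend_restrict[OF v(1) l])
  then show ?thesis
    using extend_restrict[OF u(1) l, of "\<lambda>i. u (int i)"] by simp
qed

lemma circle_mset_eq_imp_shift:
  assumes l: "l > 0" and u: "staircase l u" and v: "staircase l v"
    and eq: "circle_mset l u = circle_mset l v"
  obtains d where "v = (\<lambda>i. u (i + d))"
proof -
  have std: "staircase l (\<lambda>i. w (i + d)) \<and> 0 \<le> w (0 + d) \<and> w (int l - 1 + d) < 1"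
    if "staircase l w" "0 \<le> w d" "w (d - 1) < 0" for w d
  proof -
    have "w (d - 1 + int l) = w (d - 1) + 1" using that(1) by (simp add: staircase_def)
    moreover have "d - 1 + int l = int l - 1 + d" by simp
    ultimately show ?thesis using that staircase_shift by auto
  qed
  obtain d e where d: "0 \<le> u d" "u (d - 1) < 0" and e: "0 \<le> v e" "v (e - 1) < 0"
    using staircase_first_nonneg[OF u] staircase_first_nonneg[OF v] by metis
  have "(\<lambda>i. u (i + d)) = (\<lambda>i. v (i + e))"
    using std[OF u d] std[OF v e] circle_mset_shift[OF u] circle_mset_shift[OF v] eq
    by (intro staircase_standard_unique[OF l]) auto
  then have "u (i - e + d) = v (i - e + e)" for i
    by (rule fun_cong)
  then have "v = (\<lambda>i. u (i + (d - e)))"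
    by (auto simp: algebra_simps)
  then show thesis using that by blast
qed

lemma ex_staircase_circle_mset:
  assumes "M \<noteq> {#}" "set_mset M \<subseteq> sphere 0 1"
  obtains u where "staircase (size M) u" "circle_mset (size M) u = M" "0 \<le> (\<Sum>i<size M. u (int i))"
    "(\<Sum>i<size M. u (int i)) \<le> 1"
proof -
  define l where "l = size M"
  have l: "l > 0" using assms(1) by (simp add: l_def nonempty_has_size)
  define xs where "xs = sorted_list_of_multiset (image_mset (\<lambda>z. Arg2pi z / (2 * pi)) M)"
  have xs: "mset xs = image_mset (\<lambda>z. Arg2pi z / (2 * pi)) M" "sorted xs"
    by (simp_all add: xs_def)
  then have len: "length xs = l"
    unfolding l_def by (metis size_image_mset size_mset)
  have range: "0 \<le> xs ! i" "xs ! i < 1" if "i < l" for i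
  proof -
    have "xs ! i \<in># mset xs" using that len by simp
    then obtain z where "xs ! i = Arg2pi z / (2 * pi)" unfolding xs(1) by auto
    then show "0 \<le> xs ! i" "xs ! i < 1"
      using Arg2pi_ge_0[of z] Arg2pi_lt_2pi[of z] by auto
  qed
  define v where "v = extend l (\<lambda>i. xs ! i)"
  have "staircase l v"
    unfolding v_def
  proof (rule staircase_extend[OF l])
    fix i assume i: "i < l"
    show "extend l ((!) xs) (int i) \<le> extend l ((!) xs) (int i + 1)"
    proof (cases "Suc i < l")
      case True
      then have "extend l ((!) xs) (int i + 1) = xs ! Suc i"
        using extend_nat[OF True, of "(!) xs"] by (simp add: add.commute)
      then show ?thesis
        using i True xs(2) len by (simp add: sorted_nth_mono)
    next
      case False
      then have "int i + 1 = 0 + int l" using i by simp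
      then have "extend l ((!) xs) (int i + 1) = extend l ((!) xs) (int 0) + 1"
        using extend_add[OF l, of "(!) xs" 0] by simp
      then have "extend l ((!) xs) (int i + 1) = xs ! 0 + 1"
        using extend_nat[OF l, of "(!) xs"] by simp
      then show ?thesis
        using i l range[of i] range[of 0] by simp
    qed
  qed
  moreover have "circle_mset l v = M"
  proof -
    have "circle_mset l v = tuple_mset l (\<lambda>i. cis (2 * pi * (xs ! i)))"
      unfolding circle_mset_def v_def by (intro tuple_mset_cong) simp
    also have "\<dots> = image_mset (\<lambda>x. cis (2 * pi * x)) (mset xs)"
      unfolding tuple_mset_nth[of xs, symmetric] len by (simp add: multiset.map_comp o_def)
    also have "\<dots> = image_mset (\<lambda>z. cis (Arg2pi z)) M"
      unfolding xs(1) by (simp add: multiset.map_comp o_def)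
    also have "\<dots> = M"
      using assms(2) complex_norm_eq_1_exp by (intro multiset.map_ident_strong) (auto simp: cis_conv_exp mult.commute)
    finally show ?thesis .
  qed
  ultimately have v: "staircase l v" "circle_mset l v = M" by auto
  \<comment> \<open>Shifting by one index changes the sum by one.\<close>
  define d where "d = - \<lfloor>\<Sum>i<l. v (int i)\<rfloor>"
  have "(\<Sum>i<l. v (int i + d)) = (\<Sum>i<l. v (int i)) - of_int \<lfloor>\<Sum>i<l. v (int i)\<rfloor>"
    unfolding sum_shift[OF v(1)] by (simp add: d_def)
  then have "0 \<le> (\<Sum>i<l. v (int i + d))" "(\<Sum>i<l. v (int i + d)) \<le> 1"
    by linarith+
  then show thesis
    using that[of "\<lambda>i. v (i + d)"] staircase_shift[OF v(1)] circle_mset_shift[OF v(1)] v(2)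
    unfolding l_def by simp
qed

section \<open>A real discrete Fourier transform with drifting phases\<close>

lemma cis_eq_1_iff_int: "cis (2 * pi * a) = 1 \<longleftrightarrow> a \<in> \<int>"
proof
  assume "cis (2 * pi * a) = 1"
  then have "cos (2 * pi * a) = 1" by (metis cis.sel(1) one_complex.sel(1))
  then obtain n where "2 * pi * a = real_of_int n * 2 * pi" by (auto simp: cos_one_2pi_int)
  then have "a = of_int n" by simp
  then show "a \<in> \<int>" by simp
next
  assume "a \<in> \<int>"
  then show "cis (2 * pi * a) = 1" by (rule cis_multiple_2pi)
qed

lemma sum_cis_arith_progression:
  fixes a :: int
  assumes l: "l > 0"
  shows "(\<Sum>i<l. cis (2 * pi * (a * int i) / l + \<beta>)) = (if int l dvd a then of_nat l * cis \<beta> else 0)"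
proof -
  define z where "z = cis (2 * pi * (a / l))"
  have "cis (2 * pi * (a * int i) / l + \<beta>) = cis \<beta> * z ^ i" for i
    unfolding z_def Complex.DeMoivre cis_mult by (rule arg_cong[where f = cis]) (simp add: field_simps)
  then have eq: "(\<Sum>i<l. cis (2 * pi * (a * int i) / l + \<beta>)) = cis \<beta> * (\<Sum>i<l. z ^ i)"
    by (simp add: sum_distrib_left)
  have z1: "z = 1 \<longleftrightarrow> int l dvd a"
  proof -
    have "real_of_int a / l \<in> \<int> \<longleftrightarrow> int l dvd a"
    proof
      assume "real_of_int a / l \<in> \<int>"
      then obtain n where "real_of_int a / l = of_int n" by (auto elim: Ints_cases)
      then have "real_of_int a = of_int (int l * n)" using l by (simp add: field_simps)
      then have "a = int l * n" by (simp only: of_int_eq_iff)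
      then show "int l dvd a" by simp
    qed (use l in \<open>auto elim!: dvdE\<close>)
    then show ?thesis unfolding z_def cis_eq_1_iff_int .
  qed
  have "real l * (2 * pi * (a / l)) = 2 * pi * of_int a"
    using l by simp
  then have zl: "z ^ l = 1"
    unfolding z_def Complex.DeMoivre by (metis Ints_of_int cis_eq_1_iff_int)
  show ?thesis
  proof (cases "int l dvd a")
    case True
    then show ?thesis using z1 eq by simp
  next
    case False
    then have "z \<noteq> 1" using z1 by simp
    then have "(\<Sum>i<l. z ^ i) = 0" using zl by (simp add: sum_gp_strict)
    then show ?thesis using eq False by simp
  qed
qed

lemma int_dvd_diff_iff: "a < l \<Longrightarrow> b < l \<Longrightarrow> int l dvd int a - int b \<longleftrightarrow> a = b"
  by (simp add: mod_eq_dvd_iff[symmetric])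

text \<open>
  The kernel of the Hartley transform. It packs the two real coordinates of the conjugate Fourier modes
  \<open>k\<close> and \<open>l - k\<close> into the real coordinates with these two indices, so that no mode is complex.
\<close>

definition cas :: "real \<Rightarrow> real" where "cas x = cos x + sin x"

text \<open>
  The representative of \<open>k\<close> modulo \<open>l\<close> of least absolute value, except that \<open>l / 2\<close> is replaced by \<open>0\<close>.
  This choice is odd under \<open>k \<mapsto> l - k\<close>, which keeps the waves orthogonal for every \<open>s\<close>.
\<close>

definition freq :: "nat \<Rightarrow> nat \<Rightarrow> int" where
  "freq l k = (if 2 * k < l then int k else if l < 2 * k then int k - int l else 0)"

definition wave :: "nat \<Rightarrow> nat \<Rightarrow> real \<Rightarrow> int \<Rightarrow> real" where
  "wave l k s i = cas (2 * pi * (int k * i) / l + 2 * pi * freq l k * s / l)"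

lemma cas_mult: "cas x * cas y = cos (x - y) + sin (x + y)"
  unfolding cas_def cos_diff sin_add by (simp add: algebra_simps)

lemma freq_complement: "0 < k \<Longrightarrow> k < l \<Longrightarrow> freq l (l - k) = - freq l k"
  by (auto simp: freq_def)

lemma freq_0 [simp]: "freq l 0 = 0"
  by (simp add: freq_def)

lemma wave_0 [simp]: "wave l 0 s i = 1"
  by (simp add: wave_def cas_def)

text \<open>
  By the product formula for \<open>cas\<close>, the sum splits into a cosine sum of frequency \<open>k - k'\<close>, which
  gives the right hand side, and a sine sum of frequency \<open>k + k'\<close>. The latter is zero unless
  \<open>l\<close> divides \<open>k + k'\<close>; in that case the phases of the two waves cancel and all sines vanish.
\<close>

lemma sum_wave_mult_wave:
  assumes "k < l" "k' < l"
  shows "(\<Sum>i<l. wave l k s (int i) * wave l k' s (int i)) = (if k = k' then real l else 0)"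
proof -
  have l: "l > 0" using assms by simp
  define \<beta> where "\<beta> = 2 * pi * (freq l k - freq l k') * s / l"
  define \<gamma> where "\<gamma> = 2 * pi * (freq l k + freq l k') * s / l"
  have "wave l k s (int i) * wave l k' s (int i) =
      Re (cis (2 * pi * ((int k - int k') * int i) / l + \<beta>)) +
      Im (cis (2 * pi * ((int k + int k') * int i) / l + \<gamma>))" for i
    unfolding wave_def cas_mult \<beta>_def \<gamma>_def
    by (simp add: diff_divide_distrib add_divide_distrib algebra_simps)
  then have eq: "(\<Sum>i<l. wave l k s (int i) * wave l k' s (int i)) =
      Re (if int l dvd int k - int k' then of_nat l * cis \<beta> else 0) +
      Im (if int l dvd int k + int k' then of_nat l * cis \<gamma> else 0)"
    unfolding sum_cis_arith_progression[OF l, symmetric] Re_sum Im_sum by (simp add: sum.distrib)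
  have "int l dvd int k - int k' \<longleftrightarrow> k = k'"
    using assms by (rule int_dvd_diff_iff)
  then have 1: "Re (if int l dvd int k - int k' then of_nat l * cis \<beta> else 0) = (if k = k' then real l else 0)"
    by (auto simp: \<beta>_def)
  have "freq l k + freq l k' = 0" if dvd: "int l dvd int k + int k'"
  proof -
    obtain q where q: "int k + int k' = int l * q" using dvd by (auto elim: dvdE)
    then have "int l * q < int l * 2" "0 \<le> int l * q" using assms by linarith+
    then have "q < 2" "0 \<le> q" using l by (auto simp: zero_le_mult_iff)
    then have "q = 0 \<or> q = 1" by auto
    then have "k + k' = 0 \<or> k + k' = l" using q by auto
    then show ?thesis
    proof
      assume "k + k' = l"
      then have "k' = l - k" "0 < k" using assms by auto
      then show ?thesis using freq_complement[of k l] assms by simp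
    qed simp
  qed
  then have "Im (if int l dvd int k + int k' then of_nat l * cis \<gamma> else 0) = 0"
    by (auto simp: \<gamma>_def)
  then show ?thesis using eq 1 by simp
qed

text \<open>
  Orthogonality in the other index. Here the sine terms are not zero one by one, but they cancel in
  pairs \<open>k\<close>, \<open>l - k\<close>.
\<close>

lemma sum_wave_mult_wave':
  assumes "i < l" "i' < l"
  shows "(\<Sum>k<l. wave l k s (int i) * wave l k s (int i')) = (if i = i' then real l else 0)"
proof -
  have l: "l > 0" using assms by simp
  define h where "h k = sin (2 * pi * (int k * (int i + int i')) / l + 4 * pi * freq l k * s / l)" for k
  have "wave l k s (int i) * wave l k s (int i') =
      Re (cis (2 * pi * ((int i - int i') * int k) / l + 0)) + h k" for k
    unfolding wave_def cas_mult h_def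
    by (simp add: diff_divide_distrib add_divide_distrib algebra_simps)
  then have eq: "(\<Sum>k<l. wave l k s (int i) * wave l k s (int i')) =
      Re (if int l dvd int i - int i' then of_nat l * cis 0 else 0) + (\<Sum>k<l. h k)"
    unfolding sum_cis_arith_progression[OF l, symmetric] Re_sum by (simp add: sum.distrib)
  have "int l dvd int i - int i' \<longleftrightarrow> i = i'"
    using assms by (rule int_dvd_diff_iff)
  moreover have "(\<Sum>k<l. h k) = 0"
  proof -
    have odd: "h (l - k) = - h k" if "0 < k" "k < l" for k
    proof -
      define x where "x = 2 * pi * (int k * (int i + int i')) / l + 4 * pi * freq l k * s / l"
      have e1: "2 * pi * (int (l - k) * (int i + int i')) / l + 4 * pi * freq l (l - k) * s / l =
          - x + 2 * pi * of_int (int i + int i')"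
        unfolding x_def freq_complement[OF that] using that l by (simp add: of_nat_diff field_simps)
      have e2: "sin (- x + 2 * pi * of_int (int i + int i')) = sin (- x)"
        using sin_integer_2pi[of "of_int (int i + int i')"] cos_integer_2pi[of "of_int (int i + int i')"]
        unfolding sin_add by (simp add: mult.assoc)
      show ?thesis unfolding h_def e1 e2 sin_minus by (simp only: x_def)
    qed
    obtain n where n: "l = Suc n" using l by (metis Suc_pred)
    have "(\<Sum>k<l. h k) = h 0 + (\<Sum>j<n. h (Suc j))"
      unfolding n by (rule sum.lessThan_Suc_shift)
    moreover have "(\<Sum>j<n. h (Suc j)) = (\<Sum>j<n. h (Suc (n - Suc j)))"
      by (rule sum.nat_diff_reindex[symmetric])
    moreover have "\<dots> = (\<Sum>j<n. - h (Suc j))"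
    proof (rule sum.cong[OF refl])
      fix j assume "j \<in> {..<n}"
      then show "h (Suc (n - Suc j)) = - h (Suc j)"
        using odd[of "Suc j"] by (simp add: n Suc_diff_Suc)
    qed
    ultimately show ?thesis by (simp add: h_def sum_negf)
  qed
  ultimately show ?thesis using eq by simp
qed

text \<open>
  For \<open>g\<close> with sum \<open>1\<close>, the transform at the positive frequencies and the deviation \<open>l * g - 1\<close> from the
  barycentre of the simplex determine each other (\<open>deviation_transform\<close>, \<open>transform_deviation\<close>).
\<close>

definition transform :: "nat \<Rightarrow> real \<Rightarrow> (nat \<Rightarrow> real) \<Rightarrow> nat \<Rightarrow> real" where
  "transform l s g k = (\<Sum>i<l. g i * wave l k s (int i))"

definition deviation :: "nat \<Rightarrow> real \<Rightarrow> (nat \<Rightarrow> real) \<Rightarrow> nat \<Rightarrow> real" where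
  "deviation l s X i = (\<Sum>k\<in>{0<..<l}. X k * wave l k s (int i))"

lemma deviation_transform:
  assumes "i < l" "(\<Sum>i<l. g i) = 1"
  shows "deviation l s (transform l s g) i = real l * g i - 1"
proof -
  have "(\<Sum>k<l. transform l s g k * wave l k s (int i)) =
      (\<Sum>k<l. \<Sum>j<l. g j * (wave l k s (int j) * wave l k s (int i)))"
    by (simp add: transform_def sum_distrib_right mult.assoc)
  also have "\<dots> = (\<Sum>j<l. g j * (\<Sum>k<l. wave l k s (int j) * wave l k s (int i)))"
    by (subst sum.swap) (simp add: sum_distrib_left)
  also have "\<dots> = (\<Sum>j<l. if j = i then real l * g i else 0)"
    using assms by (intro sum.cong) (auto simp: sum_wave_mult_wave')
  also have "\<dots> = real l * g i"
    using assms by simp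
  finally have "(\<Sum>k<l. transform l s g k * wave l k s (int i)) = real l * g i" .
  moreover have "{..<l} = insert 0 {0<..<l}" using assms by auto
  ultimately show ?thesis
    using assms by (simp add: deviation_def transform_def)
qed

lemma sum_deviation_mult_wave:
  assumes "k < l"
  shows "(\<Sum>i<l. deviation l s X i * wave l k s (int i)) = (if k = 0 then 0 else real l * X k)"
proof -
  have "(\<Sum>i<l. deviation l s X i * wave l k s (int i)) =
      (\<Sum>i<l. \<Sum>j\<in>{0<..<l}. X j * (wave l j s (int i) * wave l k s (int i)))"
    by (simp add: deviation_def sum_distrib_right mult.assoc)
  also have "\<dots> = (\<Sum>j\<in>{0<..<l}. X j * (\<Sum>i<l. wave l j s (int i) * wave l k s (int i)))"
    by (subst sum.swap) (simp add: sum_distrib_left)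
  also have "\<dots> = (\<Sum>j\<in>{0<..<l}. if j = k then real l * X k else 0)"
    using assms by (intro sum.cong) (auto simp: sum_wave_mult_wave)
  also have "\<dots> = (if k = 0 then 0 else real l * X k)"
    using assms by simp
  finally show ?thesis .
qed

lemma sum_deviation: "l > 0 \<Longrightarrow> (\<Sum>i<l. deviation l s X i) = 0"
  using sum_deviation_mult_wave[of 0 l s X] by simp

lemma transform_deviation:
  assumes "0 < k" "k < l"
  shows "transform l s (\<lambda>i. (1 + deviation l s X i) / l) k = X k"
proof -
  have "transform l s (\<lambda>i. (1 + deviation l s X i) / l) k =
      ((\<Sum>i<l. wave l 0 s (int i) * wave l k s (int i)) + (\<Sum>i<l. deviation l s X i * wave l k s (int i))) / l"
    by (simp add: transform_def sum_divide_distrib sum.distrib[symmetric] field_simps)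
  then show ?thesis
    using assms unfolding sum_wave_mult_wave[OF less_trans[OF assms] assms(2)] sum_deviation_mult_wave[OF assms(2)]
    by simp
qed

section \<open>From the simplex to the disc\<close>

text \<open>
  The Minkowski functional of the simplex about its barycentre, in terms of the spectral coordinates:
  the gaps with coordinates \<open>X\<close> are nonnegative iff the gauge of \<open>X\<close> is at most \<open>1\<close>.
\<close>

definition simplex_gauge :: "nat \<Rightarrow> real \<Rightarrow> (nat \<Rightarrow> real) \<Rightarrow> real" where
  "simplex_gauge l s X = Max ((\<lambda>i. - deviation l s X i) ` {..<l})"

lemma simplex_gauge_le_iff: "l > 0 \<Longrightarrow> simplex_gauge l s X \<le> c \<longleftrightarrow> (\<forall>i<l. - deviation l s X i \<le> c)"
  unfolding simplex_gauge_def by (subst Max_le_iff) auto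

lemma simplex_gauge_nonneg:
  assumes "l > 0"
  shows "0 \<le> simplex_gauge l s X"
proof (rule ccontr)
  assume "\<not> 0 \<le> simplex_gauge l s X"
  then have "\<forall>i<l. - deviation l s X i \<le> simplex_gauge l s X" "simplex_gauge l s X < 0"
    using simplex_gauge_le_iff[OF assms] by auto
  then have "(\<Sum>i<l. deviation l s X i) > 0"
    using assms by (intro sum_pos) fastforce+
  then show False using sum_deviation[OF assms] by simp
qed

lemma simplex_gauge_eq_0_imp:
  assumes "simplex_gauge l s X = 0" "0 < k" "k < l"
  shows "X k = 0"
proof -
  have l: "l > 0" using assms by simp
  have "\<forall>i\<in>{..<l}. deviation l s X i \<ge> 0"
    using simplex_gauge_le_iff[OF l, of s X 0] assms(1) by auto
  then have "\<forall>i\<in>{..<l}. deviation l s X i = 0"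
    using sum_deviation[OF l, of s X] by (subst sum_nonneg_eq_0_iff[symmetric]) auto
  then show ?thesis
    using sum_deviation_mult_wave[OF assms(3), of s X] assms(2) l by simp
qed

lemma deviation_scale: "deviation l s (\<lambda>k. r * X k) i = r * deviation l s X i"
  by (simp add: deviation_def sum_distrib_left mult.assoc)

lemma deviation_cong: "(\<And>k. 0 < k \<Longrightarrow> k < l \<Longrightarrow> X k = Y k) \<Longrightarrow> deviation l s X i = deviation l s Y i"
  unfolding deviation_def by (intro sum.cong) auto

lemma simplex_gauge_cong: "(\<And>k. 0 < k \<Longrightarrow> k < l \<Longrightarrow> X k = Y k) \<Longrightarrow> simplex_gauge l s X = simplex_gauge l s Y"
  unfolding simplex_gauge_def using deviation_cong[of l X Y s] by simp

lemma simplex_gauge_scale: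
  assumes "l > 0" "r \<ge> 0"
  shows "simplex_gauge l s (\<lambda>k. r * X k) = r * simplex_gauge l s X"
proof -
  have "mono ((*) r)" using assms(2) by (auto intro: monoI mult_left_mono)
  then have "r * simplex_gauge l s X = Max ((*) r ` (\<lambda>i. - deviation l s X i) ` {..<l})"
    unfolding simplex_gauge_def using assms(1) by (intro mono_Max_commute) auto
  then show ?thesis
    by (simp add: simplex_gauge_def deviation_scale image_image)
qed

abbreviation vec_norm :: "nat \<Rightarrow> (nat \<Rightarrow> real) \<Rightarrow> real" where
  "vec_norm l X \<equiv> L2_set X {0<..<l}"

text \<open>
  A homeomorphism along rays from the unit ball of the gauge to that of the norm. The usual factor
  \<open>gauge / norm\<close> is singular at the origin; this one is continuous, since the denominator is
  positive on the whole ball, and its inverse is the same map with the two functionals exchanged.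
\<close>

definition to_disc :: "nat \<Rightarrow> real \<Rightarrow> (nat \<Rightarrow> real) \<Rightarrow> nat \<Rightarrow> real" where
  "to_disc l s X k = X k / (1 + vec_norm l X - simplex_gauge l s X)"

lemma vec_norm_eq_0_iff: "vec_norm l X = 0 \<longleftrightarrow> (\<forall>k. 0 < k \<and> k < l \<longrightarrow> X k = 0)"
  by (auto simp: L2_set_eq_0_iff)

lemma to_disc_denominator_pos:
  assumes "l > 0" "simplex_gauge l s X \<le> 1"
  shows "1 + vec_norm l X - simplex_gauge l s X > 0"
proof (cases "vec_norm l X = 0")
  case True
  then have "simplex_gauge l s X = simplex_gauge l s (\<lambda>k. 0 * X k)"
    by (intro simplex_gauge_cong) (use True in \<open>auto simp: vec_norm_eq_0_iff\<close>)
  then show ?thesis using simplex_gauge_scale[OF assms(1), of 0 s X] True by simp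
next
  case False
  then have "vec_norm l X > 0" using L2_set_nonneg[of X "{0<..<l}"] by linarith
  then show ?thesis using assms(2) by linarith
qed

lemma vec_norm_scale: "r \<ge> 0 \<Longrightarrow> vec_norm l (\<lambda>k. r * X k) = r * vec_norm l X"
  by (simp add: L2_set_right_distrib)

lemma vec_norm_to_disc_le_1:
  assumes "l > 0" "simplex_gauge l s X \<le> 1"
  shows "vec_norm l (to_disc l s X) \<le> 1"
proof -
  note pos = to_disc_denominator_pos[OF assms]
  have "to_disc l s X = (\<lambda>k. (1 / (1 + vec_norm l X - simplex_gauge l s X)) * X k)"
    by (simp add: to_disc_def fun_eq_iff)
  then have "vec_norm l (to_disc l s X) = vec_norm l X / (1 + vec_norm l X - simplex_gauge l s X)"
    using vec_norm_scale[of "1 / (1 + vec_norm l X - simplex_gauge l s X)" X l] pos by simp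
  then show ?thesis using pos assms(2) by simp
qed

lemma to_disc_inject:
  assumes l: "l > 0" and X: "simplex_gauge l s X \<le> 1" and X': "simplex_gauge l s X' \<le> 1"
    and eq: "\<And>k. 0 < k \<Longrightarrow> k < l \<Longrightarrow> to_disc l s X k = to_disc l s X' k"
    and k: "0 < k" "k < l"
  shows "X k = X' k"
proof -
  define Y where "Y = to_disc l s X"
  \<comment> \<open>The scaling factor is determined by the image point.\<close>
  have *: "(1 + vec_norm l Z - simplex_gauge l s Z) * (1 + simplex_gauge l s Y - vec_norm l Y) = 1 \<and>
      Z k = (1 + vec_norm l Z - simplex_gauge l s Z) * Y k"
    if Z: "simplex_gauge l s Z \<le> 1" and ZY: "\<And>k. 0 < k \<Longrightarrow> k < l \<Longrightarrow> to_disc l s Z k = Y k" for Z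
  proof -
    define r where "r = 1 + vec_norm l Z - simplex_gauge l s Z"
    have r: "r > 0" unfolding r_def by (rule to_disc_denominator_pos[OF l Z])
    have Zk: "Z k = r * Y k" if "0 < k" "k < l" for k
      using ZY[OF that] r by (simp add: to_disc_def r_def[symmetric] field_simps)
    have "simplex_gauge l s Z = r * simplex_gauge l s Y"
      using simplex_gauge_scale[OF l, of r s Y] simplex_gauge_cong[of l Z "\<lambda>k. r * Y k" s] Zk r by simp
    moreover have "vec_norm l Z = vec_norm l (\<lambda>k. r * Y k)"
      using Zk by (intro L2_set_cong) auto
    then have "vec_norm l Z = r * vec_norm l Y"
      using vec_norm_scale[of r Y l] r by simp
    ultimately have "r = 1 + r * vec_norm l Y - r * simplex_gauge l s Y"
      using r_def by linarith
    then show ?thesis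
      using Zk[OF k] unfolding r_def[symmetric] by (simp add: algebra_simps)
  qed
  define a where "a = 1 + vec_norm l X - simplex_gauge l s X"
  define b where "b = 1 + vec_norm l X' - simplex_gauge l s X'"
  define c where "c = 1 + simplex_gauge l s Y - vec_norm l Y"
  have "a * c = 1" "X k = a * Y k"
    using *[OF X] unfolding a_def c_def Y_def by auto
  moreover have "b * c = 1" "X' k = b * Y k"
    using *[OF X'] eq unfolding b_def c_def Y_def by auto
  ultimately have "a = b" by (metis mult.assoc mult.commute mult.right_neutral)
  with \<open>X k = a * Y k\<close> \<open>X' k = b * Y k\<close> show ?thesis by simp
qed

lemma to_disc_surj:
  assumes l: "l > 0" and Y: "vec_norm l Y \<le> 1"
  obtains X where "simplex_gauge l s X \<le> 1" "\<And>k. to_disc l s X k = Y k"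
proof -
  \<comment> \<open>The inverse of the radial map, with gauge and norm exchanged.\<close>
  define r where "r = 1 / (1 + simplex_gauge l s Y - vec_norm l Y)"
  define X where "X = (\<lambda>k. r * Y k)"
  have pos: "1 + simplex_gauge l s Y - vec_norm l Y > 0"
  proof (cases "simplex_gauge l s Y = 0")
    case True
    then have "vec_norm l Y = 0"
      using simplex_gauge_eq_0_imp[of l s Y] by (simp add: vec_norm_eq_0_iff)
    then show ?thesis using True by simp
  next
    case False
    then show ?thesis using simplex_gauge_nonneg[OF l, of s Y] Y by linarith
  qed
  then have r: "r > 0" by (simp add: r_def)
  have rr: "r * (1 + simplex_gauge l s Y - vec_norm l Y) = 1" using pos by (simp add: r_def)
  have g: "simplex_gauge l s X = r * simplex_gauge l s Y" and n: "vec_norm l X = r * vec_norm l Y"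
    unfolding X_def using simplex_gauge_scale[OF l, of r s Y] vec_norm_scale[of r Y l] r by auto
  have "r * simplex_gauge l s Y \<le> 1"
  proof -
    have "r * vec_norm l Y \<le> r" using Y r by (simp add: mult_left_le)
    then show ?thesis using rr by (simp add: algebra_simps)
  qed
  moreover have "1 + vec_norm l X - simplex_gauge l s X = r"
    using rr unfolding g n by (simp add: algebra_simps)
  then have "to_disc l s X k = Y k" for k
    using r by (simp add: to_disc_def X_def)
  ultimately show thesis using that[of X] g by simp
qed

text \<open>
  A cyclic shift multiplies the Fourier mode \<open>k\<close> by a phase. Letting \<open>s\<close> grow by \<open>1\<close> compensates it, up
  to a multiple of \<open>2 * pi\<close>, because the phase drifts with a speed congruent to \<open>k\<close> modulo \<open>l\<close>.
  At the frequency \<open>l / 2\<close> there is no drift, and the shift shows up as a sign.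
\<close>

lemma transform_cyclic_shift:
  fixes g :: "int \<Rightarrow> real"
  assumes l: "l > 0" and per: "\<And>i. g (i + int l) = g i" and k: "k < l"
  shows "transform l (s + 1) (\<lambda>i. g (int i + 1)) k =
    (if 2 * k = l then - 1 else 1) * transform l s (\<lambda>i. g (int i)) k"
proof -
  define F where "F i = g i * cas (2 * pi * (int k * i) / l + 2 * pi * freq l k * s / l + 2 * pi * (freq l k - k) / l)" for i :: int
  have "g (int i + 1) * wave l k (s + 1) (int i) = F (int i + 1)" for i
    unfolding F_def wave_def
    by (intro arg_cong2[where f = "(*)"] arg_cong[where f = cas])
       (simp_all add: add_divide_distrib diff_divide_distrib algebra_simps)
  then have "transform l (s + 1) (\<lambda>i. g (int i + 1)) k = (\<Sum>i<l. F (int i + 1))"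
    by (simp add: transform_def)
  also have "\<dots> = (\<Sum>i<l. F (int i)) + F (int l) - F 0"
    by (rule periodic_sum_shift)
  also have "F (int l) = F 0"
  proof -
    have "cas (2 * pi * real k + x) = cas x" for x
      using sin_integer_2pi[of "real k"] cos_integer_2pi[of "real k"]
      by (simp add: cas_def sin_add cos_add mult.assoc)
    moreover have "2 * pi * real_of_int (int k * int l) / real l = 2 * pi * real k"
      using l by simp
    moreover have "g (int l) = g 0" using per[of 0] by simp
    ultimately show ?thesis
      unfolding F_def by (simp only: add.assoc) simp
  qed
  finally have "transform l (s + 1) (\<lambda>i. g (int i + 1)) k = (\<Sum>i<l. F (int i))"
    by simp
  moreover have "F i = (if 2 * k = l then - 1 else 1) * (g i * wave l k s i)" for i
  proof -
    define x where "x = 2 * pi * (int k * i) / l + 2 * pi * freq l k * s / l"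
    consider "2 * k < l" | "l < 2 * k" | "2 * k = l" by linarith
    then have "cas (x + 2 * pi * (freq l k - k) / l) = (if 2 * k = l then - 1 else 1) * cas x"
    proof cases
      case 1
      then show ?thesis by (simp add: freq_def)
    next
      case 2
      then have "x + 2 * pi * (freq l k - k) / l = x - 2 * pi"
        using l by (simp add: freq_def field_simps)
      then show ?thesis using 2 by (simp add: cas_def sin_diff cos_diff)
    next
      case 3
      then have "x + 2 * pi * (freq l k - k) / l = x - pi"
        using l by (simp add: freq_def field_simps flip: 3)
      then show ?thesis using 3 by (simp add: cas_def sin_diff cos_diff)
    qed
    then show ?thesis by (simp add: F_def wave_def x_def)
  qed
  ultimately show ?thesis
    by (simp add: transform_def sum_distrib_left)
qed

section \<open>A fundamental domain for configurations on the circle\<close>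

text \<open>
  Lifts whose sum lies in \<open>[0, 1]\<close>: each configuration has exactly one of them with sum below \<open>1\<close>.
  The values beyond the index \<open>l - 1\<close> are fixed to make the domain compact.
\<close>

definition fundamental_domain :: "nat \<Rightarrow> (nat \<Rightarrow> real) set" where
  "fundamental_domain l = {t. (\<forall>i\<ge>l. t i = 0) \<and>
     (\<forall>i<l. extend l t (int i) \<le> extend l t (int i + 1)) \<and> 0 \<le> (\<Sum>i<l. t i) \<and> (\<Sum>i<l. t i) \<le> 1}"

lemma staircase_fundamental_domain:
  "l > 0 \<Longrightarrow> t \<in> fundamental_domain l \<Longrightarrow> staircase l (extend l t)"
  by (rule staircase_extend) (auto simp: fundamental_domain_def)

lemma ex_fundamental_domain:
  assumes "staircase l u" "l > 0" "0 \<le> (\<Sum>i<l. u (int i))" "(\<Sum>i<l. u (int i)) \<le> 1"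
  obtains t where "t \<in> fundamental_domain l" "extend l t = u"
proof -
  define t where "t i = (if i < l then u (int i) else 0)" for i
  have "extend l t = u"
    using assms(1,2) by (rule extend_restrict) (simp add: t_def)
  moreover from this have "t \<in> fundamental_domain l"
    using assms unfolding fundamental_domain_def staircase_def
    by (auto simp: t_def mono_def)
  ultimately show thesis using that by blast
qed

lemma fundamental_domain_eqI:
  assumes "t \<in> fundamental_domain l" "t' \<in> fundamental_domain l" "extend l t = extend l t'"
  shows "t = t'"
proof
  fix i
  show "t i = t' i"
    using assms(1,2) extend_nat[of i l t] extend_nat[of i l t'] unfolding assms(3)
    by (cases "i < l") (auto simp: fundamental_domain_def)
qed

lemma continuous_on_coordinate: "continuous_on S (\<lambda>t :: nat \<Rightarrow> real. t i)"
  by (rule continuous_on_subset[OF continuous_on_product_coordinates]) simp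

lemma continuous_on_extend: "continuous_on S (\<lambda>t. extend l t i)"
  unfolding extend_def by (intro continuous_intros continuous_on_coordinate)

lemma compact_fundamental_domain:
  assumes l: "l > 0"
  shows "compact (fundamental_domain l)"
proof -
  have "closed (fundamental_domain l)"
    unfolding fundamental_domain_def
    by (intro closed_Collect_conj closed_Collect_all closed_Collect_imp closed_Collect_le closed_Collect_eq
        open_Collect_const continuous_intros continuous_on_coordinate continuous_on_extend)
  \<comment> \<open>Values of one lift at indices below \<open>l\<close> differ by at most \<open>1\<close>, so the bound on the sum
    bounds each of them.\<close>
  moreover have "fundamental_domain l \<subseteq> PiE UNIV (\<lambda>i. if i < l then {-1..2} else {0})"
  proof
    fix t assume t: "t \<in> fundamental_domain l"
    then have u: "staircase l (extend l t)" by (rule staircase_fundamental_domain[OF l])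
    have close: "t i \<le> t j + 1" if "i < l" "j < l" for i j
    proof -
      have "extend l t (int i) \<le> extend l t (int j + int l)"
        using u that unfolding staircase_def by (auto dest!: monoD[of _ "int i" "int j + int l"])
      then show ?thesis using u that unfolding staircase_def by simp
    qed
    have "-1 \<le> t i \<and> t i \<le> 2" if i: "i < l" for i
    proof -
      have "(\<Sum>j<l. t i) \<le> (\<Sum>j<l. t j + 1)" "(\<Sum>j<l. t j) \<le> (\<Sum>j<l. t i + 1)"
        using close i by (intro sum_mono; simp)+
      then have "real l * t i \<le> (\<Sum>j<l. t j) + real l" "(\<Sum>j<l. t j) \<le> real l * t i + real l"
        by (simp_all add: sum.distrib distrib_left)
      moreover have "0 \<le> (\<Sum>j<l. t j)" "(\<Sum>j<l. t j) \<le> 1" "1 \<le> real l"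
        using t l by (auto simp: fundamental_domain_def)
      ultimately have "real l * t i \<le> real l * 2" "real l * (- 1) \<le> real l * t i"
        by linarith+
      then show ?thesis using l by (metis mult_le_cancel_left_pos of_nat_0_less_iff)
    qed
    then show "t \<in> PiE UNIV (\<lambda>i. if i < l then {-1..2} else {0})"
      using t by (auto simp: fundamental_domain_def)
  qed
  moreover have "compactin (product_topology (\<lambda>_. euclideanreal) UNIV) (PiE UNIV (\<lambda>i::nat. if i < l then {-1..2} else {0}))"
    by (simp add: compactin_PiE)
  then have "compact (PiE UNIV (\<lambda>i::nat. if i < l then {-1..2::real} else {0}))"
    by (simp add: euclidean_product_topology)
  ultimately show ?thesis
    using compact_Int_closed by (metis inf.absorb2)
qed

definition circle_points :: "nat \<Rightarrow> (nat \<Rightarrow> real) \<Rightarrow> complex multiset" where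
  "circle_points l t = circle_mset l (extend l t)"

lemma quotient_map_circle_points:
  assumes l: "l > 0"
  shows "quotient_map (top_of_set (fundamental_domain l)) (sym_product circle l) (circle_points l)"
proof -
  let ?E = "top_of_set (fundamental_domain l)"
  define c where "c t = (\<lambda>i\<in>{..<l}. cis (2 * pi * t i))" for t :: "nat \<Rightarrow> real"
  have pts: "circle_points l = tuple_mset l \<circ> c"
    by (auto simp: circle_points_def circle_mset_def c_def fun_eq_iff intro!: tuple_mset_cong)
  have "continuous_on S (\<lambda>t. cis (2 * pi * t i))" for S :: "(nat \<Rightarrow> real) set" and i
    unfolding cis_conv_exp by (intro continuous_intros continuous_on_coordinate)
  then have c: "continuous_map ?E (power_topology circle l) c"
    by (auto simp: continuous_map_componentwise c_def continuous_map_in_subtopology)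
  have "compact_space ?E"
    using compact_fundamental_domain[OF l] by (simp add: compact_space_subtopology)
  then have "closed_map ?E (power_topology circle l) c"
    using c by (intro continuous_imp_closed_map) (auto simp: Hausdorff_space_product_topology Hausdorff_space_subtopology)
  then have "closed_map ?E (sym_product circle l) (circle_points l)"
    unfolding pts using closed_map_tuple_mset by (rule closed_map_compose)
  moreover have cont: "continuous_map ?E (sym_product circle l) (circle_points l)"
    unfolding pts using c quotient_imp_continuous_map[OF quotient_map_tuple_mset]
    by (rule continuous_map_compose)
  moreover have "circle_points l ` topspace ?E = topspace (sym_product circle l)"
  proof
    show "circle_points l ` topspace ?E \<subseteq> topspace (sym_product circle l)"
      using cont by (rule continuous_map_image_subset_topspace)
    show "topspace (sym_product circle l) \<subseteq> circle_points l ` topspace ?E"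
    proof
      fix M assume "M \<in> topspace (sym_product circle l)"
      then have M: "size M = l" "set_mset M \<subseteq> sphere 0 1" by (auto simp: topspace_sym_product)
      then obtain u where u: "staircase l u" "circle_mset l u = M" "0 \<le> (\<Sum>i<l. u (int i))" "(\<Sum>i<l. u (int i)) \<le> 1"
        using ex_staircase_circle_mset[of M] l by (metis less_irrefl size_empty)
      then obtain t where "t \<in> fundamental_domain l" "extend l t = u"
        using ex_fundamental_domain l by metis
      then show "M \<in> circle_points l ` topspace ?E"
        using u(2) by (auto simp: circle_points_def)
    qed
  qed
  ultimately show ?thesis
    by (intro continuous_closed_imp_quotient_map)
qed

definition gap :: "nat \<Rightarrow> (nat \<Rightarrow> real) \<Rightarrow> int \<Rightarrow> real" where
  "gap l t i = extend l t (i + 1) - extend l t i"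

definition spectrum :: "nat \<Rightarrow> (nat \<Rightarrow> real) \<Rightarrow> nat \<Rightarrow> real" where
  "spectrum l t = transform l (\<Sum>i<l. t i) (\<lambda>i. gap l t (int i))"

lemma gap_periodic: "l > 0 \<Longrightarrow> gap l t (i + int l) = gap l t i"
  using extend_add[of l t i] extend_add[of l t "i + 1"] by (simp add: gap_def algebra_simps)

lemma sum_gap: "l > 0 \<Longrightarrow> (\<Sum>i<l. gap l t (int i)) = 1"
  using extend_add[of l t 0] by (simp add: gap_def sum_subtractf periodic_sum_shift)

lemma deviation_spectrum:
  "i < l \<Longrightarrow> deviation l (\<Sum>i<l. t i) (spectrum l t) i = real l * gap l t (int i) - 1"
  unfolding spectrum_def using sum_gap[of l t] by (intro deviation_transform) auto

text \<open>
  The maximum runs over all integers, which makes its invariance under a shift of the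
  index evident.
\<close>

lemma simplex_gauge_spectrum:
  assumes l: "l > 0"
  shows "simplex_gauge l (\<Sum>i<l. t i) (spectrum l t) = Max (range (\<lambda>i. 1 - real l * gap l t i))"
proof -
  have per: "gap l t (i mod int l) = gap l t i" for i
    using quasiperiodic_int[of "gap l t" l 0 "i mod int l" "i div int l"] gap_periodic[OF l] by simp
  have "(\<lambda>i. - deviation l (\<Sum>i<l. t i) (spectrum l t) i) ` {..<l} = (\<lambda>i. 1 - real l * gap l t (int i)) ` {..<l}"
    by (intro image_cong) (auto simp: deviation_spectrum)
  also have "\<dots> = range (\<lambda>i. 1 - real l * gap l t i)"
  proof
    show "range (\<lambda>i. 1 - real l * gap l t i) \<subseteq> (\<lambda>i. 1 - real l * gap l t (int i)) ` {..<l}"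
    proof
      fix x assume "x \<in> range (\<lambda>i. 1 - real l * gap l t i)"
      then obtain i where "x = 1 - real l * gap l t i" by blast
      then have "x = 1 - real l * gap l t (int (nat (i mod int l)))" using per l by simp
      moreover have "nat (i mod int l) < l" using l by (simp add: nat_less_iff)
      ultimately show "x \<in> (\<lambda>i. 1 - real l * gap l t (int i)) ` {..<l}" by blast
    qed
  qed auto
  finally show ?thesis by (simp add: simplex_gauge_def)
qed

lemma simplex_gauge_spectrum_le_1:
  assumes "l > 0" "t \<in> fundamental_domain l"
  shows "simplex_gauge l (\<Sum>i<l. t i) (spectrum l t) \<le> 1"
  using assms unfolding simplex_gauge_le_iff[OF assms(1)]
  by (auto simp: deviation_spectrum gap_def fundamental_domain_def)

text \<open>
  The frequencies \<open>1, \<dots>, l - 1\<close>, reordered so that for even \<open>l\<close> the frequency \<open>l / 2\<close> becomes the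
  coordinate \<open>0\<close>, which is the one reflected by the standard nonorientable bundle.
\<close>

definition coordinate_order :: "nat \<Rightarrow> nat \<Rightarrow> nat" where
  "coordinate_order l r = Transposition.transpose 1 (l div 2) (Suc r)"

lemma bij_betw_coordinate_order: "bij_betw (coordinate_order l) {..<l - 1} {0<..<l}"
proof -
  have "bij_betw Suc {..<l - 1} {0<..<l}"
    by (rule bij_betwI[where g = "\<lambda>k. k - 1"]) auto
  moreover have "bij_betw (Transposition.transpose 1 (l div 2)) {0<..<l} {0<..<l}"
  proof (cases "l \<le> 1")
    case True
    then show ?thesis by (simp add: bij_betw_def)
  next
    case False
    then have "Transposition.transpose 1 (l div 2) permutes {0<..<l}"
      by (intro permutes_swap_id) auto
    then show ?thesis by (rule permutes_imp_bij)
  qed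
  ultimately have "bij_betw (Transposition.transpose 1 (l div 2) \<circ> Suc) {..<l - 1} {0<..<l}"
    by (rule bij_betw_trans)
  then show ?thesis by (simp add: coordinate_order_def[abs_def] o_def)
qed

lemma coordinate_order_eq_half_iff:
  assumes "r < l - 1"
  shows "2 * coordinate_order l r = l \<longleftrightarrow> even l \<and> r = 0"
proof -
  have "coordinate_order l r = l div 2 \<longleftrightarrow> r = 0"
    by (auto simp: coordinate_order_def Transposition.transpose_def)
  moreover have "2 * coordinate_order l r = l \<longleftrightarrow> even l \<and> coordinate_order l r = l div 2"
    by presburger
  ultimately show ?thesis by blast
qed

definition disc_point :: "nat \<Rightarrow> (nat \<Rightarrow> real) \<Rightarrow> nat \<Rightarrow> real" where
  "disc_point l t r = (if r < l - 1
     then to_disc l (\<Sum>i<l. t i) (spectrum l t) (coordinate_order l r) else 0)"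

definition cylinder :: "nat \<Rightarrow> (real \<times> (nat \<Rightarrow> real)) topology" where
  "cylinder j = prod_topology (top_of_set {0..1}) (closed_disc j)"

definition cylinder_point :: "nat \<Rightarrow> (nat \<Rightarrow> real) \<Rightarrow> real \<times> (nat \<Rightarrow> real)" where
  "cylinder_point l t = (\<Sum>i<l. t i, disc_point l t)"

lemma closed_disc_eq_top_of_set:
  "closed_disc j = top_of_set {x. (\<forall>i\<ge>j. x i = 0) \<and> (\<Sum>i<j. (x i)\<^sup>2) \<le> 1}"
  unfolding closed_disc_def Euclidean_space_def euclidean_product_topology subtopology_subtopology
  by (rule arg_cong[where f = top_of_set]) auto

lemma sum_coordinate_order:
  "(\<Sum>r<l - 1. (f (coordinate_order l r))\<^sup>2) = (vec_norm l f)\<^sup>2"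
proof -
  have "(\<Sum>r<l - 1. (f (coordinate_order l r))\<^sup>2) = (\<Sum>k\<in>{0<..<l}. (f k)\<^sup>2)"
    by (rule sum.reindex_bij_betw[OF bij_betw_coordinate_order])
  then show ?thesis by (simp add: L2_set_def sum_nonneg)
qed

lemma sum_disc_point_sq: "(\<Sum>r<l - 1. (disc_point l t r)\<^sup>2) = (vec_norm l (to_disc l (\<Sum>i<l. t i) (spectrum l t)))\<^sup>2"
  unfolding sum_coordinate_order[symmetric] by (intro sum.cong) (auto simp: disc_point_def)

lemma continuous_on_Max:
  fixes f :: "nat \<Rightarrow> 'a::topological_space \<Rightarrow> real"
  assumes "n > 0" "\<And>i. i < n \<Longrightarrow> continuous_on S (f i)"
  shows "continuous_on S (\<lambda>x. Max ((\<lambda>i. f i x) ` {..<n}))"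
  using assms
proof (induction n rule: nat_induct_non_zero)
  case 1
  then show ?case by (simp add: lessThan_Suc)
next
  case (Suc n)
  have "Max ((\<lambda>i. f i x) ` {..<Suc n}) = max (f n x) (Max ((\<lambda>i. f i x) ` {..<n}))" for x
  proof -
    have "(\<lambda>i. f i x) ` {..<n} \<noteq> {}"
      using Suc.hyps by (simp add: lessThan_empty_iff)
    then show ?thesis
      unfolding lessThan_Suc image_insert by (intro Max_insert) auto
  qed
  moreover have "continuous_on S (f n)" "continuous_on S (\<lambda>x. Max ((\<lambda>i. f i x) ` {..<n}))"
    using Suc.IH Suc.prems by simp_all
  ultimately show ?case
    by (simp only:) (rule continuous_on_max)
qed

lemma continuous_on_disc_point:
  assumes l: "l > 0"
  shows "continuous_on (fundamental_domain l) (disc_point l)"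
proof -
  have s: "continuous_on S (\<lambda>t :: nat \<Rightarrow> real. \<Sum>i<l. t i)" for S
    by (intro continuous_intros continuous_on_coordinate)
  have g: "continuous_on S (\<lambda>t. gap l t i)" for S i
    unfolding gap_def by (intro continuous_intros continuous_on_extend)
  have w: "continuous_on S (\<lambda>t. wave l k (\<Sum>i<l. t i) i)" for S k i
  proof -
    have "wave l k x i = cos (2 * pi * (int k * i) / l + (2 * pi * freq l k / l) * x) +
        sin (2 * pi * (int k * i) / l + (2 * pi * freq l k / l) * x)" for x
      by (simp add: wave_def cas_def)
    then show ?thesis
      by (simp only:) (intro continuous_on_add continuous_on_cos continuous_on_sin continuous_on_mult
          continuous_on_const s)
  qed
  have X: "continuous_on S (\<lambda>t. spectrum l t k)" for S k
    unfolding spectrum_def transform_def by (intro continuous_on_sum continuous_on_mult g w)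
  have N: "continuous_on S (\<lambda>t. simplex_gauge l (\<Sum>i<l. t i) (spectrum l t))" for S
    unfolding simplex_gauge_def deviation_def
    by (intro continuous_on_Max[OF l] continuous_on_minus continuous_on_sum continuous_on_mult X w)
  have "continuous_on (fundamental_domain l) (\<lambda>t. to_disc l (\<Sum>i<l. t i) (spectrum l t) k)" for k
    unfolding to_disc_def L2_set_def
  proof (intro continuous_intros X N ballI)
    fix t assume "t \<in> fundamental_domain l"
    from to_disc_denominator_pos[OF l simplex_gauge_spectrum_le_1[OF l this]]
    show "1 + sqrt (\<Sum>i\<in>{0<..<l}. (spectrum l t i)\<^sup>2) - simplex_gauge l (\<Sum>i<l. t i) (spectrum l t) \<noteq> 0"
      by (simp add: L2_set_def)
  qed
  then have "continuous_on (fundamental_domain l) (\<lambda>t. disc_point l t r)" for r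
    unfolding disc_point_def by (cases "r < l - 1") auto
  then show ?thesis
    by (rule continuous_on_coordinatewise_then_product)
qed

text \<open>
  As the fundamental domain is compact, a continuous bijection is enough. The sum and the spectrum determine the
  gaps, and the gaps determine the lift up to an additive constant that the sum fixes. Conversely every
  point of the gauge ball is the spectrum of nonnegative gaps with sum \<open>1\<close>.
\<close>

lemma homeomorphic_map_cylinder_point:
  assumes l: "l > 0"
  shows "homeomorphic_map (top_of_set (fundamental_domain l)) (cylinder (l - 1)) (cylinder_point l)"
proof (rule continuous_imp_homeomorphic_map)
  let ?E = "top_of_set (fundamental_domain l)"
  show "compact_space ?E"
    using compact_fundamental_domain[OF l] by (simp add: compact_space_subtopology)
  show "Hausdorff_space (cylinder (l - 1))"
    unfolding cylinder_def closed_disc_eq_top_of_set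
    by (simp add: Hausdorff_space_prod_topology Hausdorff_space_subtopology)
  have "(\<Sum>r<l - 1. (disc_point l t r)\<^sup>2) \<le> 1" if "t \<in> fundamental_domain l" for t
    unfolding sum_disc_point_sq
    using vec_norm_to_disc_le_1[OF l simplex_gauge_spectrum_le_1[OF l that]]
    by (simp add: abs_square_le_1 L2_set_nonneg)
  then show cont: "continuous_map ?E (cylinder (l - 1)) (cylinder_point l)"
    unfolding cylinder_def closed_disc_eq_top_of_set cylinder_point_def[abs_def]
    using continuous_on_disc_point[OF l]
    by (intro continuous_map_pairedI continuous_map_into_subtopology)
       (auto simp: disc_point_def fundamental_domain_def intro!: continuous_intros continuous_on_coordinate)
  show "inj_on (cylinder_point l) (topspace ?E)"
  proof (rule inj_onI)
    fix t t' assume t: "t \<in> topspace ?E" "t' \<in> topspace ?E" and eq: "cylinder_point l t = cylinder_point l t'"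
    define s where "s = (\<Sum>i<l. t i)"
    have s': "(\<Sum>i<l. t' i) = s" using eq by (simp add: cylinder_point_def s_def)
    have td: "to_disc l s (spectrum l t) k = to_disc l s (spectrum l t') k" if "0 < k" "k < l" for k
    proof -
      have "k \<in> coordinate_order l ` {..<l - 1}"
        using bij_betw_coordinate_order[of l] that by (simp add: bij_betw_def)
      then obtain r where r: "r < l - 1" "k = coordinate_order l r" by auto
      have "disc_point l t r = disc_point l t' r" using eq by (simp add: cylinder_point_def)
      then show ?thesis using r s' by (simp add: disc_point_def s_def)
    qed
    have "spectrum l t k = spectrum l t' k" if "0 < k" "k < l" for k
      using to_disc_inject[OF l _ _ td that] simplex_gauge_spectrum_le_1[OF l, of t]
        simplex_gauge_spectrum_le_1[OF l, of t'] t s' by (simp add: s_def)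
    then have "deviation l s (spectrum l t) i = deviation l s (spectrum l t') i" for i
      by (rule deviation_cong)
    then have gap: "gap l t (int i) = gap l t' (int i)" if "i < l" for i
      using deviation_spectrum[OF that, of t] deviation_spectrum[OF that, of t'] l
      by (simp add: s_def[symmetric] s')
    have diff: "t i - t' i = t 0 - t' 0" if "i < l" for i
      using that
    proof (induction i)
      case (Suc i)
      then show ?case
        using gap[of i] extend_nat[OF Suc.prems, of t] extend_nat[OF Suc.prems, of t']
        by (simp add: gap_def add.commute)
    qed simp
    have "(\<Sum>i<l. t i - t' i) = (\<Sum>i<l. t 0 - t' 0)"
      by (rule sum.cong[OF refl], rule diff) simp
    then have "t 0 = t' 0"
      using s' l by (simp add: sum_subtractf s_def)
    show "t = t'"
    proof
      fix i
      show "t i = t' i"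
        using diff[of i] \<open>t 0 = t' 0\<close> t by (cases "i < l") (auto simp: fundamental_domain_def)
    qed
  qed
  show "cylinder_point l ` topspace ?E = topspace (cylinder (l - 1))"
  proof
    show "cylinder_point l ` topspace ?E \<subseteq> topspace (cylinder (l - 1))"
      using cont by (rule continuous_map_image_subset_topspace)
    show "topspace (cylinder (l - 1)) \<subseteq> cylinder_point l ` topspace ?E"
    proof
      fix p assume "p \<in> topspace (cylinder (l - 1))"
      then obtain s y where p: "p = (s, y)" and s: "0 \<le> s" "s \<le> 1"
        and y: "\<And>i. i \<ge> l - 1 \<Longrightarrow> y i = 0" "(\<Sum>i<l - 1. (y i)\<^sup>2) \<le> 1"
        by (auto simp: cylinder_def closed_disc_eq_top_of_set)
      define Y where "Y k = y (inv_into {..<l - 1} (coordinate_order l) k)" for k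
      have inj: "inj_on (coordinate_order l) {..<l - 1}"
        using bij_betw_coordinate_order by (auto simp: bij_betw_def)
      then have Y: "Y (coordinate_order l r) = y r" if "r < l - 1" for r
        using that by (simp add: Y_def)
      have "(vec_norm l Y)\<^sup>2 = (\<Sum>i<l - 1. (y i)\<^sup>2)"
        unfolding sum_coordinate_order[symmetric] using Y by (intro sum.cong) auto
      then have "vec_norm l Y \<le> 1"
        using y(2) power2_le_imp_le[of "vec_norm l Y" 1] by simp
      then obtain X where X: "simplex_gauge l s X \<le> 1" "\<And>k. to_disc l s X k = Y k"
        using to_disc_surj[OF l] by metis
      define g where "g i = (1 + deviation l s X i) / l" for i
      have g0: "g i \<ge> 0" if "i < l" for i
        using X(1) that l unfolding simplex_gauge_le_iff[OF l] by (force simp: g_def)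
      have g1: "(\<Sum>i<l. g i) = 1"
        using sum_deviation[OF l, of s X] l by (simp add: g_def sum_divide_distrib[symmetric] sum.distrib)
      define c where "c = (s - (\<Sum>j<l. \<Sum>i<j. g i)) / l"
      define t where "t j = (if j < l then c + (\<Sum>i<j. g i) else 0)" for j
      have sum_t: "(\<Sum>j<l. t j) = s"
        using l by (simp add: t_def sum.distrib c_def)
      have gap: "gap l t (int i) = g i" if "i < l" for i
      proof (cases "Suc i < l")
        case True
        have "extend l t (int i + 1) = t (Suc i)"
          using extend_nat[OF True, of t] by (simp add: add.commute)
        then show ?thesis using True by (simp add: gap_def t_def)
      next
        case False
        then have i: "l = Suc i" using that by simp
        have "extend l t (int i + 1) = t 0 + 1"
          using extend_add[OF l, of t 0] extend_nat[OF l, of t] i by (simp add: add.commute)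
        then show ?thesis using g1 that unfolding i by (simp add: gap_def t_def i)
      qed
      have t: "t \<in> fundamental_domain l"
        unfolding fundamental_domain_def
      proof (intro CollectI conjI allI impI)
        fix i assume "i < l"
        then show "extend l t (int i) \<le> extend l t (int i + 1)"
          using gap[of i] g0[of i] by (simp add: gap_def)
      qed (use sum_t s in \<open>auto simp: t_def\<close>)
      have "spectrum l t k = X k" if "0 < k" "k < l" for k
      proof -
        have "spectrum l t k = transform l s g k"
          unfolding spectrum_def transform_def sum_t using gap by (intro sum.cong) auto
        then show ?thesis
          using transform_deviation[OF that, of s X] by (simp add: g_def[abs_def])
      qed note sp = this
      have "to_disc l s (spectrum l t) k = Y k" if "0 < k" "k < l" for k
      proof -
        have "vec_norm l (spectrum l t) = vec_norm l X" using sp by (intro L2_set_cong) auto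
        moreover have "simplex_gauge l s (spectrum l t) = simplex_gauge l s X"
          using sp by (rule simplex_gauge_cong)
        ultimately show ?thesis using sp[OF that] X(2)[of k] by (simp add: to_disc_def)
      qed
      moreover have "0 < coordinate_order l r \<and> coordinate_order l r < l" if "r < l - 1" for r
        using bij_betw_coordinate_order[of l] that by (auto simp: bij_betw_def)
      ultimately have "disc_point l t = y"
        using Y y(1) by (auto simp: disc_point_def sum_t fun_eq_iff)
      then have "cylinder_point l t = p"
        by (simp add: cylinder_point_def sum_t p)
      then show "p \<in> cylinder_point l ` topspace ?E" using t by auto
    qed
  qed
qed

section \<open>The symmetric product of the circle\<close>

definition monodromy :: "nat \<Rightarrow> (nat \<Rightarrow> real) \<Rightarrow> nat \<Rightarrow> real" where
  "monodromy l x = (if even l then x(0 := - x 0) else x)"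

definition glue :: "nat \<Rightarrow> real \<times> (nat \<Rightarrow> real) \<Rightarrow> real \<times> (nat \<Rightarrow> real)" where
  "glue l = (\<lambda>(s, x). if s = 1 then (0, monodromy l x) else (s, x))"

text \<open>
  Shifting the index keeps the set of gaps, hence the gauge, and changes the spectrum at most in the
  sign of the frequency \<open>l / 2\<close>, hence keeps the norm. So the two disc points differ only in that sign.
\<close>

lemma disc_point_shift:
  assumes l: "l > 0" and shift: "\<And>i. extend l t' (i + 1) = extend l t i"
    and sums: "(\<Sum>i<l. t i) = (1 :: real)" "(\<Sum>i<l. t' i) = 0"
  shows "disc_point l t' = monodromy l (disc_point l t)"
proof -
  define \<epsilon> :: "nat \<Rightarrow> real" where "\<epsilon> k = (if 2 * k = l then - 1 else 1)" for k
  have \<epsilon>: "\<epsilon> k * \<epsilon> k = 1" for k by (simp add: \<epsilon>_def)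
  have gap: "gap l t' (i + 1) = gap l t i" for i
    using shift[of i] shift[of "i + 1"] by (simp add: gap_def)
  have "spectrum l t k = \<epsilon> k * spectrum l t' k" if "k < l" for k
    using transform_cyclic_shift[OF l, where g = "gap l t'" and s = 0, OF gap_periodic[OF l] that]
    by (simp add: spectrum_def sums gap \<epsilon>_def)
  then have sp: "spectrum l t' k = \<epsilon> k * spectrum l t k" if "k < l" for k
    using that \<epsilon>[of k] by (metis mult.assoc mult_1)
  have "range (\<lambda>i. 1 - real l * gap l t i) = range (\<lambda>i. 1 - real l * gap l t' i)"
  proof -
    have "range (\<lambda>i. 1 - real l * gap l t i) = (\<lambda>j. 1 - real l * gap l t' j) ` range (\<lambda>i. i + 1)"
      unfolding image_image gap ..
    moreover have "range (\<lambda>i. i + 1) = (UNIV :: int set)"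
      by (metis surj_def diff_add_cancel)
    ultimately show ?thesis by simp
  qed
  then have gauge: "simplex_gauge l 0 (spectrum l t') = simplex_gauge l 1 (spectrum l t)"
    using simplex_gauge_spectrum[OF l, of t] simplex_gauge_spectrum[OF l, of t'] by (simp add: sums)
  have norm: "vec_norm l (spectrum l t') = vec_norm l (spectrum l t)"
    unfolding L2_set_def
    by (intro arg_cong[where f = sqrt] sum.cong) (auto simp: sp \<epsilon>_def)
  have td: "to_disc l 0 (spectrum l t') k = \<epsilon> k * to_disc l 1 (spectrum l t) k" if "k < l" for k
    using sp[OF that] by (simp add: to_disc_def gauge norm)
  have "disc_point l t' r = monodromy l (disc_point l t) r" for r
  proof (cases "r < l - 1")
    case True
    then have "coordinate_order l r < l"
      using bij_betw_coordinate_order[of l] by (auto simp: bij_betw_def)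
    then show ?thesis
      using True coordinate_order_eq_half_iff[OF True] td[of "coordinate_order l r"]
      by (auto simp: disc_point_def monodromy_def sums \<epsilon>_def)
  next
    case False
    moreover have "even l \<Longrightarrow> r \<noteq> 0" using False l by (auto elim!: evenE)
    ultimately show ?thesis by (auto simp: disc_point_def monodromy_def)
  qed
  then show ?thesis by blast
qed

lemma sum_extend: "(\<Sum>i<l. extend l t (int i)) = (\<Sum>i<l. t i)"
  by (intro sum.cong) auto

text \<open>
  A lift with sum \<open>1\<close> and its shift with sum \<open>0\<close> give the same configuration, and gluing
  identifies their images. So both maps factor through the lifts with sum below \<open>1\<close>.
\<close>

lemma glue_representative:
  assumes l: "l > 0" and t: "t \<in> fundamental_domain l"
  obtains t' where "t' \<in> fundamental_domain l" "(\<Sum>i<l. t' i) < 1"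
    "circle_points l t' = circle_points l t" "glue l (cylinder_point l t) = cylinder_point l t'"
proof (cases "(\<Sum>i<l. t i) = 1")
  case False
  then show ?thesis
    using that[of t] t by (auto simp: fundamental_domain_def glue_def cylinder_point_def)
next
  case True
  note u = staircase_fundamental_domain[OF l t]
  have sum0: "(\<Sum>i<l. extend l t (int i + (- 1))) = 0"
    unfolding sum_shift[OF u] sum_extend True by simp
  then obtain t' where t': "t' \<in> fundamental_domain l" "extend l t' = (\<lambda>i. extend l t (i + (- 1)))"
    using ex_fundamental_domain[OF staircase_shift[OF u] l] by (metis order_refl zero_le_one)
  have sum': "(\<Sum>i<l. t' i) = 0"
    using sum0 unfolding sum_extend[of l t', symmetric] t'(2) .
  have "disc_point l t' = monodromy l (disc_point l t)"
    by (rule disc_point_shift[OF l _ True sum']) (simp add: t'(2))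
  then have "glue l (cylinder_point l t) = cylinder_point l t'"
    using True sum' by (simp add: glue_def cylinder_point_def)
  moreover have "circle_points l t' = circle_points l t"
    using circle_mset_shift[OF u] by (simp add: circle_points_def t'(2) del: add_uminus_conv_diff)
  ultimately show ?thesis using that[OF t'(1)] sum' by simp
qed

text \<open>
  Two lifts of a configuration differ by a shift, and a shift by \<open>d\<close> changes the sum by \<open>d\<close>; two sums
  in \<open>[0, 1)\<close> can only differ by \<open>0\<close>.
\<close>

lemma circle_points_inject:
  assumes l: "l > 0" and t: "t \<in> fundamental_domain l" "(\<Sum>i<l. t i) < 1"
    and t': "t' \<in> fundamental_domain l" "(\<Sum>i<l. t' i) < 1"
    and eq: "circle_points l t = circle_points l t'"
  shows "t = t'"
proof -
  note u = staircase_fundamental_domain[OF l t(1)]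
  obtain d where d: "extend l t' = (\<lambda>i. extend l t (i + d))"
    using circle_mset_eq_imp_shift[OF l u staircase_fundamental_domain[OF l t'(1)]] eq
    unfolding circle_points_def by metis
  have "(\<Sum>i<l. t' i) = (\<Sum>i<l. t i) + of_int d"
    using sum_shift[OF u, of d] sum_extend[of l t] sum_extend[of l t'] unfolding d by simp
  moreover have "0 \<le> (\<Sum>i<l. t i)" "0 \<le> (\<Sum>i<l. t' i)"
    using t(1) t'(1) by (simp_all add: fundamental_domain_def)
  ultimately have "real_of_int d < 1" "- 1 < real_of_int d"
    using t(2) t'(2) by linarith+
  then have "d = 0" by linarith
  then have "extend l t = extend l t'" using d by simp
  with t(1) t'(1) show ?thesis by (rule fundamental_domain_eqI)
qed

lemma sym_product_circle_homeomorphic_space_glued_cylinder: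
  assumes l: "l > 0"
  shows "sym_product circle l homeomorphic_space quotient_topology (cylinder (l - 1)) (glue l)"
proof (rule quotient_maps_same_fibres_imp_homeomorphic_space[OF quotient_map_circle_points[OF l]])
  let ?E = "top_of_set (fundamental_domain l)"
  have hom: "homeomorphic_map ?E (cylinder (l - 1)) (cylinder_point l)"
    by (rule homeomorphic_map_cylinder_point[OF l])
  then have "quotient_map ?E (cylinder (l - 1)) (cylinder_point l)"
    by (simp add: homeomorphic_map_def)
  then show "quotient_map ?E (quotient_topology (cylinder (l - 1)) (glue l)) (glue l \<circ> cylinder_point l)"
    using quotient_map_quotient_topology by (rule quotient_map_compose)
  fix t1 t2 assume "t1 \<in> topspace ?E" "t2 \<in> topspace ?E"
  then have t: "t1 \<in> fundamental_domain l" "t2 \<in> fundamental_domain l" by auto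
  obtain t1' where t1': "t1' \<in> fundamental_domain l" "(\<Sum>i<l. t1' i) < 1"
    "circle_points l t1' = circle_points l t1" "glue l (cylinder_point l t1) = cylinder_point l t1'"
    using glue_representative[OF l t(1)] by metis
  obtain t2' where t2': "t2' \<in> fundamental_domain l" "(\<Sum>i<l. t2' i) < 1"
    "circle_points l t2' = circle_points l t2" "glue l (cylinder_point l t2) = cylinder_point l t2'"
    using glue_representative[OF l t(2)] by metis
  have "circle_points l t1 = circle_points l t2 \<longleftrightarrow> t1' = t2'"
    using circle_points_inject[OF l t1'(1,2) t2'(1,2)] t1'(3) t2'(3) by auto
  also have "\<dots> \<longleftrightarrow> cylinder_point l t1' = cylinder_point l t2'"
    using homeomorphic_imp_injective_map[OF hom] t1'(1) t2'(1) by (auto dest: inj_onD)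
  finally show "circle_points l t1 = circle_points l t2 \<longleftrightarrow>
      (glue l \<circ> cylinder_point l) t1 = (glue l \<circ> cylinder_point l) t2"
    using t1'(4) t2'(4) by simp
qed

lemma glued_cylinder_even:
  assumes "even l"
  shows "quotient_topology (cylinder (l - 1)) (glue l) = nonorientable_disc_bundle (l - 1)"
proof -
  have monodromy: "monodromy l = (\<lambda>x. x(0 := - x 0))"
    using assms by (simp add: monodromy_def[abs_def])
  show ?thesis
    unfolding nonorientable_disc_bundle_def cylinder_def glue_def monodromy ..
qed

lemma cis_eq_cis_unit_interval:
  assumes "0 \<le> s" "s \<le> 1" "0 \<le> s'" "s' \<le> 1"
  shows "cis (2 * pi * s) = cis (2 * pi * s') \<longleftrightarrow> (if s = 1 then 0 else s) = (if s' = 1 then 0 else s')"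
proof -
  have "cis (2 * pi * s) = cis (2 * pi * s') \<longleftrightarrow> cis (2 * pi * s) / cis (2 * pi * s') = 1"
    by simp
  also have "\<dots> \<longleftrightarrow> s - s' \<in> \<int>"
    unfolding cis_divide cis_eq_1_iff_int[symmetric] by (simp add: right_diff_distrib)
  also have "\<dots> \<longleftrightarrow> (if s = 1 then 0 else s) = (if s' = 1 then 0 else s')"
  proof
    assume "s - s' \<in> \<int>"
    then obtain n where n: "s - s' = of_int n" by (auto elim: Ints_cases)
    then have "n = 0 \<or> n = 1 \<or> n = -1" using assms by linarith
    then show "(if s = 1 then 0 else s) = (if s' = 1 then 0 else s')"
      using n assms by auto
  next
    assume "(if s = 1 then 0 else s) = (if s' = 1 then 0 else s')"
    then show "s - s' \<in> \<int>" by (auto split: if_splits)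
  qed
  finally show ?thesis .
qed

lemma glued_cylinder_odd:
  assumes "odd l"
  shows "quotient_topology (cylinder (l - 1)) (glue l) homeomorphic_space
    prod_topology circle (closed_disc (l - 1))"
proof (rule quotient_maps_same_fibres_imp_homeomorphic_space[OF quotient_map_quotient_topology])
  let ?e = "\<lambda>(s, x). (cis (2 * pi * s), x)"
  have l: "l > 0" using assms by (auto intro: Nat.gr0I)
  have H: "Hausdorff_space (closed_disc (l - 1))"
    unfolding closed_disc_eq_top_of_set by (simp add: Hausdorff_space_subtopology)
  have cis: "continuous_map (top_of_set {0..1}) circle (\<lambda>s. cis (2 * pi * s))"
    unfolding cis_conv_exp by (auto simp: continuous_map_in_subtopology intro!: continuous_intros)
  show "quotient_map (cylinder (l - 1)) (prod_topology circle (closed_disc (l - 1))) ?e"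
  proof (rule continuous_imp_quotient_map)
    show "continuous_map (cylinder (l - 1)) (prod_topology circle (closed_disc (l - 1))) ?e"
      unfolding cylinder_def using cis continuous_map_id[of "closed_disc (l - 1)"]
      by (intro continuous_map_prod_top[THEN iffD2, of _ _ _ _ _ "\<lambda>x. x"]) (auto simp: id_def)
    have "compact_space (top_of_set (fundamental_domain l))"
      using compact_fundamental_domain[OF l] by (simp add: compact_space_subtopology)
    then show "compact_space (cylinder (l - 1))"
      using homeomorphic_map_cylinder_point[OF l] homeomorphic_compact_space
        homeomorphic_map_imp_homeomorphic_space by blast
    show "Hausdorff_space (prod_topology circle (closed_disc (l - 1)))"
      using H by (simp add: Hausdorff_space_prod_topology Hausdorff_space_subtopology)
    have "z \<in> (\<lambda>s. cis (2 * pi * s)) ` {0..1}" if "z \<in> sphere 0 1" for z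
      using that Arg2pi_ge_0[of z] Arg2pi_lt_2pi[of z] complex_norm_eq_1_exp[of z]
      by (intro image_eqI[of _ _ "Arg2pi z / (2 * pi)"]) (auto simp: cis_conv_exp)
    then have im: "(\<lambda>s. cis (2 * pi * s)) ` {0..1} = sphere 0 1"
      by auto
    show "?e ` topspace (cylinder (l - 1)) = topspace (prod_topology circle (closed_disc (l - 1)))"
      unfolding cylinder_def topspace_prod_topology
      by (intro map_prod_surj_on[unfolded map_prod_def]) (auto simp: im)
  qed
  fix p p' assume "p \<in> topspace (cylinder (l - 1))" "p' \<in> topspace (cylinder (l - 1))"
  then obtain s x s' x' where "p = (s, x)" "p' = (s', x')" "0 \<le> s" "s \<le> 1" "0 \<le> s'" "s' \<le> 1"
    by (auto simp: cylinder_def)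
  then show "glue l p = glue l p' \<longleftrightarrow> ?e p = ?e p'"
    using assms cis_eq_cis_unit_interval[of s s'] by (auto simp: glue_def monodromy_def)
qed

section \<open>The strata\<close>

lemma sym_product_0: "sym_product X 0 = discrete_topology {{#}}"
proof -
  have "topspace (sym_product X 0) = {{#}}"
    by (auto simp: topspace_sym_product)
  then have "discrete_topology {{#}} = sym_product X 0"
    unfolding discrete_topology_unique by (metis openin_topspace singletonD)
  then show ?thesis by simp
qed

theorem D_stratum_homeomorphic_space:
  assumes "openin CP1 \<Omega>" "connectedin CP1 \<Omega>"
    and circle: "subtopology CP1 (semistable \<Omega>) homeomorphic_space circle"
  shows "D_stratum_topology \<Omega> k l m homeomorphic_space
    prod_topology (sym_product circle l) (Euclidean_space (2 * (k + m)))"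
proof -
  note discs = stable_unstable_homeomorphic_space_complex[OF assms]
  let ?A = "sym_product (subtopology CP1 (stable \<Omega>)) k"
  let ?B = "sym_product (subtopology CP1 (semistable \<Omega>)) l"
  let ?C = "sym_product (subtopology CP1 (unstable \<Omega>)) m"
  have "stable \<Omega> \<inter> semistable \<Omega> = {}" "stable \<Omega> \<inter> unstable \<Omega> = {}" "semistable \<Omega> \<inter> unstable \<Omega> = {}"
    using closure_of_subset[of \<Omega> CP1] by (auto simp: stable_def semistable_def unstable_def)
  then have "D_stratum_topology \<Omega> k l m homeomorphic_space prod_topology ?A (prod_topology ?B ?C)"
    unfolding D_stratum_topology_def D_stratum_def
    using assms(1) discs(3) by (intro stratum_homeomorphic_space_prod_sym_product) (auto simp: stable_def)
  also have "\<dots> homeomorphic_space prod_topology ?A (prod_topology ?C ?B)"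
    by (intro homeomorphic_space_prod_topology homeomorphic_space_refl homeomorphic_space_prod_topology_swap)
  also have "\<dots> homeomorphic_space prod_topology (prod_topology ?A ?C) ?B"
    using homeomorphic_space_prod_topology_assoc homeomorphic_space_sym by blast
  also have "\<dots> homeomorphic_space prod_topology ?B (prod_topology ?A ?C)"
    by (rule homeomorphic_space_prod_topology_swap)
  also have "\<dots> homeomorphic_space prod_topology (sym_product circle l) (Euclidean_space (2 * (k + m)))"
  proof (rule homeomorphic_space_prod_topology)
    show "?B homeomorphic_space sym_product circle l"
      by (rule homeomorphic_space_sym_product[OF circle])
    have "?A homeomorphic_space Euclidean_space (2 * k)" "?C homeomorphic_space Euclidean_space (2 * m)"
      using discs(1,2) homeomorphic_space_sym_product homeomorphic_space_trans
        sym_product_complex_homeomorphic_space_Euclidean_space by blast+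
    then have "prod_topology ?A ?C homeomorphic_space prod_topology (Euclidean_space (2 * k)) (Euclidean_space (2 * m))"
      by (rule homeomorphic_space_prod_topology)
    also have "\<dots> homeomorphic_space Euclidean_space (2 * k + 2 * m)"
      by (rule homeomorphic_space_prod_Euclidean_space)
    finally show "prod_topology ?A ?C homeomorphic_space Euclidean_space (2 * (k + m))"
      by (simp add: distrib_left)
  qed
  finally show ?thesis .
qed

theorem proposition10:
  fixes \<Omega> :: "complex option set" and k l m :: nat
  assumes "stability_theory \<Omega>"
    and "openin CP1 \<Omega>" and "connectedin CP1 \<Omega>"
    and "subtopology CP1 (semistable \<Omega>) homeomorphic_space circle"
  shows "D_stratum_topology \<Omega> k 0 m homeomorphic_space Euclidean_space (2 * (k + m)) \<and>
    (l > 0 \<and> odd l \<longrightarrow> D_stratum_topology \<Omega> k l m homeomorphic_space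
       prod_topology circle
         (prod_topology (closed_disc (l - 1)) (Euclidean_space (2 * (k + m))))) \<and>
    (l > 0 \<and> even l \<longrightarrow> D_stratum_topology \<Omega> k l m homeomorphic_space
       prod_topology (nonorientable_disc_bundle (l - 1)) (Euclidean_space (2 * (k + m))))"
proof (intro conjI impI)
  let ?E = "Euclidean_space (2 * (k + m))"
  note stratum = D_stratum_homeomorphic_space[OF assms(2,3,4)]
  show "D_stratum_topology \<Omega> k 0 m homeomorphic_space ?E"
    using stratum[of k 0 m] prod_topology_homeomorphic_space_right[OF sym_product_0]
    by (rule homeomorphic_space_trans)
  have glued: "D_stratum_topology \<Omega> k l m homeomorphic_space
      prod_topology (quotient_topology (cylinder (l - 1)) (glue l)) ?E" if "l > 0"
    using stratum[of k l m] homeomorphic_space_prod_topology[OF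
        sym_product_circle_homeomorphic_space_glued_cylinder[OF that] homeomorphic_space_refl]
    by (rule homeomorphic_space_trans)
  show "D_stratum_topology \<Omega> k l m homeomorphic_space
      prod_topology circle (prod_topology (closed_disc (l - 1)) ?E)" if "l > 0 \<and> odd l"
  proof -
    have "D_stratum_topology \<Omega> k l m homeomorphic_space
        prod_topology (prod_topology circle (closed_disc (l - 1))) ?E"
      using glued homeomorphic_space_prod_topology[OF glued_cylinder_odd homeomorphic_space_refl]
        that homeomorphic_space_trans by blast
    then show ?thesis
      using homeomorphic_space_prod_topology_assoc by (rule homeomorphic_space_trans)
  qed
  show "D_stratum_topology \<Omega> k l m homeomorphic_space
      prod_topology (nonorientable_disc_bundle (l - 1)) ?E" if "l > 0 \<and> even l"
    using glued that glued_cylinder_even[of l] by simp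
qed

end
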